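(* Let $a,b\in\mathbb{Z}$ with $ab\neq 0$, let $g_4(x)=x^4+ax^2+b$, $\delta=a^2-4b$ and $\mathcal{W}=\delta/\gcd(2,a)^2$. Suppose that $g_4(x)$ is irreducible over $\mathbb{Q}$, and let $G_4$ denote its Galois group over $\mathbb{Q}$. Then $g_4(x)$ is monogenic with $G_4\simeq$ (1) $4\mathrm{T}1$ if and only if $g_4(x)\in\{x^4\pm 4x^2+2,\ x^4-5x^2+5\}$; (2) $4\mathrm{T}2$ if and only if $\mathcal{W}$ is squarefree and $g_4(x)=x^4+ax^2+1$ with $a\bmod 4\in\{0,3\}$; (3) $4\mathrm{T}3$ if and only if $\mathcal{W}$ and $b\neq 1$ are squarefree, $b\delta$ is not a square, and $(a\bmod 4,\ b\bmod 4)\in\mathcal{R}$, where $$\mathcal{R}=\{(0,1),(0,2),(2,2),(2,3),(1,3),(3,2),(3,1),(3,3)\}.$$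
   Context: A monic polynomial $F(x)\in\mathbb{Z}[x]$ is called monogenic if $F(x)$ is irreducible over $\mathbb{Q}$ and $\{1,\theta,\theta^2,\ldots,\theta^{\deg(F)-1}\}$ is a $\mathbb{Z}$-basis for the ring of integers of $\mathbb{Q}(\theta)$, where $F(\theta)=0$. The notation $4\mathrm{T}n$ denotes the $n$-th transitive group of degree 4 in the standard (Butler--McKay) numbering: $4\mathrm{T}1$ is the cyclic group of order 4, $4\mathrm{T}2$ is the Klein four-group, and $4\mathrm{T}3$ is the dihedral group of order 8. For integers $r$ and $N>1$, $r\bmod N$ denotes the unique $z\in\{0,1,\ldots,N-1\}$ with $r\equiv z\pmod N$. "Square" means the square of an integer. *)

theory Defs
  imports
    "HOL-Algebra.Algebraic_Closure_Type"
    "HOL-Algebra.Generated_Fields"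
    "HOL-Algebra.Bij"
    "HOL-Algebra.Sym_Groups"
    "HOL-Computational_Algebra.Computational_Algebra"
begin

definition complex_roots :: "int poly \<Rightarrow> complex set" where
  "complex_roots F = {z. poly (map_poly of_int F) z = 0}"

text \<open>Number fields are realised as subfields of the complex numbers.\<close>

definition rat_adjoin :: "complex set \<Rightarrow> complex set" where
  "rat_adjoin S = generate_field ring_of_type_algebra (\<rat> \<union> S)"

definition ring_of_integers :: "complex set \<Rightarrow> complex set" where
  "ring_of_integers K = {z \<in> K. algebraic_int z}"

text \<open>The complex numbers are regarded as an integer module. Using the \<^emph>\<open>set\<close> of powers
  of \<open>\<theta>\<close> is harmless below: if \<open>\<theta>\<close> is a root of an irreducible polynomial of degree \<open>n\<close>,
  its first \<open>n\<close> powers are distinct.\<close>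

definition is_int_basis :: "complex set \<Rightarrow> complex set \<Rightarrow> bool" where
  "is_int_basis B M \<longleftrightarrow>
     \<not> module.dependent (\<lambda>(k::int) z. of_int k * z) B \<and>
     module.span (\<lambda>(k::int) z. of_int k * z) B = M"

text \<open>The root \<open>\<theta>\<close> is left arbitrary in the informal definition; all roots of an irreducible
  polynomial are conjugate, so quantifying over all of them is the same as choosing one.\<close>

definition monogenic :: "int poly \<Rightarrow> bool" where
  "monogenic F \<longleftrightarrow>
     lead_coeff F = 1 \<and>
     Factorial_Ring.irreducible (map_poly rat_of_int F) \<and>
     (\<forall>\<theta>\<in>complex_roots F.
        is_int_basis {\<theta> ^ i | i. i < Polynomial.degree F} (ring_of_integers (rat_adjoin {\<theta>})))"

text \<open>Field automorphisms of the splitting field of \<open>F\<close> that fix the rationals, under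
  composition. As in \<^const>\<open>Bij\<close>, they are extensional functions on the field, so that each
  automorphism is counted once.\<close>

definition galois_group :: "int poly \<Rightarrow> (complex \<Rightarrow> complex) monoid" where
  "galois_group F =
     (let K = rat_adjoin (complex_roots F);
          R = (ring_of_type_algebra :: complex ring)\<lparr>carrier := K\<rparr>
      in (BijGroup K)\<lparr>carrier := {\<sigma> \<in> Bij K. \<sigma> \<in> ring_hom R R \<and> (\<forall>q\<in>\<rat>. \<sigma> q = q)}\<rparr>)"

text \<open>The transitive groups 4T1, 4T2 and 4T3, given by generators in the symmetric group
  on \<open>{1,2,3,4}\<close>.\<close>

definition perm_group4 :: "(nat \<Rightarrow> nat) set \<Rightarrow> (nat \<Rightarrow> nat) monoid" where
  "perm_group4 S = (sym_group 4)\<lparr>carrier := generate (sym_group 4) S\<rparr>"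

definition T4_1 :: "(nat \<Rightarrow> nat) monoid" where
  "T4_1 = perm_group4 {cycle_of_list [1, 2, 3, 4]}"

definition T4_2 :: "(nat \<Rightarrow> nat) monoid" where
  "T4_2 = perm_group4 {cycle_of_list [1, 4] \<circ> cycle_of_list [2, 3],
                       cycle_of_list [1, 2] \<circ> cycle_of_list [3, 4]}"

definition T4_3 :: "(nat \<Rightarrow> nat) monoid" where
  "T4_3 = perm_group4 {cycle_of_list [1, 2, 3, 4], cycle_of_list [1, 3]}"

text \<open>The quotient \<open>\<W> = \<delta> / gcd(2,a)\<^sup>2\<close> may therefore be formed with integer division.\<close>

lemma gcd_2_power2_dvd: "(gcd 2 a)\<^sup>2 dvd a\<^sup>2 - 4 * b" for a b :: int
proof (cases "even a")
  case True
  then obtain c where "a = 2 * c" ..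
  then have "a\<^sup>2 - 4 * b = 4 * (c\<^sup>2 - b)"
    by (simp add: power2_eq_square algebra_simps)
  moreover from True have "gcd 2 a = 2"
    by (simp add: gcd_proj1_iff)
  ultimately show ?thesis
    by simp
next
  case False
  then have "coprime 2 a"
    by simp
  then show ?thesis
    by simp
qed

end

theory Submission
  imports Defs "Jordan_Normal_Form.Char_Poly" "HOL-Number_Theory.Cong"
begin

text \<open>
  Let \<open>\<theta>\<close> be a root and \<open>\<phi> = \<theta>\<^sup>2\<close>. An element of \<open>\<rat>(\<theta>)\<close> is \<open>(A + B \<theta>) / p\<close> with \<open>A, B\<close> in \<open>\<rat>(\<phi>)\<close>;
  if it is integral, so are its trace \<open>2 A / p\<close> and norm \<open>(A\<^sup>2 - \<phi> B\<^sup>2) / p\<^sup>2\<close> over \<open>\<rat>(\<phi>)\<close>.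
  When \<open>\<W>\<close> is squarefree and the residues of \<open>(a, b)\<close> modulo 4 are admissible, the integers of
  \<open>\<rat>(\<phi>)\<close> are \<open>\<int>[\<phi>]\<close>, and for every prime \<open>p\<close> the two conditions force \<open>p\<close> to divide \<open>A\<close> (for \<open>p = 2\<close>
  this is a finite check modulo 4) and then, as \<open>b\<close> is squarefree, also \<open>B\<close>. If one of the conditions
  fails, Dedekind's criterion suggests an integral element with a denominator.

  The splitting field is reached from \<open>\<rat>\<close> by adjoining square roots, so its automorphisms are
  found by extending homomorphisms one quadratic step at a time. They permute the roots
  \<open>\<theta>, \<beta>, -\<theta>, -\<beta>\<close> as symmetries of a square; all eight symmetries occur unless \<open>\<theta> \<beta>\<close> is rational
  (\<open>b\<close> is a square) or \<open>\<theta> \<beta> (\<theta>\<^sup>2 - \<beta>\<^sup>2)\<close> is rational (\<open>b \<delta>\<close> is a square). In the last case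
  squarefreeness of \<open>b\<close> and \<open>\<W>\<close> gives \<open>b = \<W>\<close>, which leaves finitely many polynomials.
\<close>

text \<open>The obstacle in the integrality argument is B: unlike A / p, the part B \<theta> / p
  does not lie in the field generated by \<phi>, where integers are understood. Once p divides A,
  the norm makes \<phi> B^2 / p^2 integral, and one more factor \<phi> turns this into the square of
  \<phi> B / p, which does lie in that field. Its coordinates, together with the norm congruences
  modulo p^2, carry divisibility over to B because p divides b at most once.

  The eight residue pairs are what is left of sixteen: if 4 divides b, then b is not squarefree;
  (2,1) makes 4 divide the reduced discriminant; and each of (0,3), (1,1), (1,2) admits an explicit
  integral element with denominator 2.

  For the Galois group only one direction is argued directly: each squareness condition determines
  the group. The converses follow because the conditions exhaust all cases and the three groups are
  pairwise non-isomorphic.\<close>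

section \<open>Sums and products of algebraic integers\<close>

abbreviation (input) int_scale :: "int \<Rightarrow> complex \<Rightarrow> complex" where
  "int_scale \<equiv> \<lambda>k z. of_int k * z"

lemma int_module: "Modules.module int_scale"
  by unfold_locales (auto simp: algebra_simps)

text \<open>No interpretation of the module locale: its laws would enter \<open>algebra_simps\<close>, where they loop
  against \<open>of_int_mult\<close>.\<close>

lemmas int_span_zero = Modules.module.span_zero[OF int_module]
  and int_span_add = Modules.module.span_add[OF int_module]
  and int_span_scale = Modules.module.span_scale[OF int_module]
  and int_span_base = Modules.module.span_base[OF int_module]
  and int_span_sum = Modules.module.span_sum[OF int_module]
  and int_span_finite = Modules.module.span_finite[OF int_module]
  and int_span_induct_alt = Modules.module.span_induct_alt[OF int_module]

abbreviation int_span :: "complex set \<Rightarrow> complex set" where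
  "int_span \<equiv> Modules.module.span int_scale"

lemma int_span_mult:
  assumes "\<And>b. b \<in> B \<Longrightarrow> x * b \<in> int_span B" "v \<in> int_span B"
  shows "x * v \<in> int_span B"
  using assms(2)
proof (induction rule: int_span_induct_alt[consumes 1, case_names base step])
  case base
  then show ?case by (simp add: int_span_zero)
next
  case (step c y z)
  have "x * (of_int c * y + z) = of_int c * (x * y) + x * z"
    by (simp add: algebra_simps)
  then show ?case
    using step assms(1) by (simp add: int_span_add int_span_scale)
qed

text \<open>The determinant trick: writing each \<open>z * b\<close> as an integer combination of
  \<open>B\<close> makes the vector of generators an eigenvector of an integer matrix with
  eigenvalue \<open>z\<close>, and the characteristic polynomial of that matrix is monic. The
  element \<open>v0\<close> only serves to make the eigenvector nonzero.\<close>

lemma algebraic_int_if_stable_module: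
  fixes z :: complex
  assumes "finite B" and "v0 \<in> B" "v0 \<noteq> 0"
    and stable: "\<And>b. b \<in> B \<Longrightarrow> z * b \<in> int_span B"
  shows "algebraic_int z"
proof -
  define n where "n = card B"
  obtain e where e: "bij_betw e {0..<n} B"
    using ex_bij_betw_nat_finite[OF assms(1)] n_def by auto
  have "\<exists>u. z * b = (\<Sum>v\<in>B. of_int (u v) * v)" if "b \<in> B" for b
    using stable[OF that] by (auto simp: int_span_finite[OF assms(1)])
  then obtain u where u: "\<And>b. b \<in> B \<Longrightarrow> z * b = (\<Sum>v\<in>B. of_int (u b v) * v)"
    by metis
  define A where "A = mat n n (\<lambda>(i, j). u (e i) (e j))"
  define A' where "A' = (map_mat of_int A :: complex mat)"
  define w where "w = vec n e"
  have A: "A \<in> carrier_mat n n" by (simp add: A_def)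
  then have A': "A' \<in> carrier_mat n n" by (simp add: A'_def)
  have eB: "e i \<in> B" if "i < n" for i
    using e that by (auto simp: bij_betw_def)
  have "A' *\<^sub>v w = z \<cdot>\<^sub>v w"
  proof (rule eq_vecI)
    fix i assume "i < dim_vec (z \<cdot>\<^sub>v w)"
    then have i: "i < n" by (simp add: w_def)
    have "(A' *\<^sub>v w) $ i = (\<Sum>j\<in>{0..<n}. of_int (u (e i) (e j)) * e j)"
      using i by (simp add: A'_def A_def w_def scalar_prod_def)
    also have "\<dots> = (\<Sum>v\<in>B. of_int (u (e i) v) * v)"
      by (rule sum.reindex_bij_betw[OF e])
    finally show "(A' *\<^sub>v w) $ i = (z \<cdot>\<^sub>v w) $ i"
      using i u[OF eB[OF i]] by (simp add: w_def)
  qed (simp add: A'_def A_def w_def)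
  moreover have "w \<noteq> 0\<^sub>v n"
  proof
    assume w0: "w = 0\<^sub>v n"
    obtain i where i: "i < n" "e i = v0"
      using e assms(2) by (metis atLeastLessThan_iff bij_betw_iff_bijections)
    then have "w $ i = v0" by (simp add: w_def)
    with w0 i assms(3) show False by simp
  qed
  ultimately have "eigenvalue A' z"
    using A' by (auto simp: eigenvalue_def eigenvector_def w_def intro!: exI[of _ "vec n e"])
  then have "poly (char_poly A') z = 0"
    using eigenvalue_root_char_poly[OF A'] by simp
  moreover have "char_poly A' = map_poly of_int (char_poly A)"
    unfolding A'_def by (rule of_int_hom.char_poly_hom[OF A])
  moreover have "lead_coeff (char_poly A) = 1"
    using degree_monic_char_poly[OF A] by simp
  ultimately show ?thesis
    by (auto simp: algebraic_int_altdef_ipoly)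
qed

lemma algebraic_int_powers_stable:
  fixes x :: complex
  assumes "algebraic_int x"
  obtains m where "m > 0" "x ^ m \<in> int_span ((^) x ` {..<m})"
proof -
  from assms obtain p :: "int poly" where p: "poly (map_poly of_int p) x = 0" "lead_coeff p = 1"
    by (auto simp: algebraic_int_altdef_ipoly)
  define m where "m = Polynomial.degree p"
  have "poly (map_poly of_int p) x = (\<Sum>i\<le>m. of_int (poly.coeff p i) * x ^ i)"
    by (simp add: poly_altdef m_def)
  also have "\<dots> = (\<Sum>i<m. of_int (poly.coeff p i) * x ^ i) + x ^ m"
    using p(2) by (simp add: lessThan_Suc_atMost[symmetric] m_def)
  finally have "x ^ m = (\<Sum>i<m. of_int (- poly.coeff p i) * x ^ i)"
    using p(1) by (simp add: sum_negf eq_neg_iff_add_eq_0 add.commute)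
  also have "\<dots> \<in> int_span ((^) x ` {..<m})"
    by (intro int_span_sum int_span_scale int_span_base) auto
  finally have *: "x ^ m \<in> int_span ((^) x ` {..<m})" .
  \<comment> \<open>For \<open>m = 0\<close> the relation would place 1 in the span of the empty
    set.\<close>
  moreover have "m > 0"
  proof (rule ccontr)
    assume "\<not> m > 0"
    with * show False by (simp add: Modules.module.span_empty[OF int_module])
  qed
  ultimately show thesis using that by blast
qed

text \<open>The products \<open>x ^ i * y ^ j\<close> with bounded exponents span a module stable
  under both \<open>x\<close> and \<open>y\<close>. A monic relation is needed only when an exponent
  reaches its bound.\<close>

lemma algebraic_int_add_mult:
  fixes x y :: complex
  assumes "algebraic_int x" "algebraic_int y"
  shows "algebraic_int (x + y)" and "algebraic_int (x * y)"
proof -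
  obtain m where m: "m > 0" "x ^ m \<in> int_span ((^) x ` {..<m})"
    using algebraic_int_powers_stable[OF assms(1)] .
  obtain n where n: "n > 0" "y ^ n \<in> int_span ((^) y ` {..<n})"
    using algebraic_int_powers_stable[OF assms(2)] .
  define B where "B = (\<lambda>(i, j). x ^ i * y ^ j) ` ({..<m} \<times> {..<n})"
  have BI: "x ^ i * y ^ j \<in> int_span B" if "i < m" "j < n" for i j
    using that by (intro int_span_base) (auto simp: B_def)
  have xm: "v * y ^ j \<in> int_span B" if "v \<in> int_span ((^) x ` {..<m})" "j < n" for v j
    using that(1)
  proof (induction rule: int_span_induct_alt[consumes 1, case_names base step])
    case base
    then show ?case by (simp add: int_span_zero)
  next
    case (step c v w)
    then obtain i where "i < m" "v = x ^ i" by auto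
    then have "of_int c * (v * y ^ j) + w * y ^ j \<in> int_span B"
      using step that(2) by (intro int_span_add int_span_scale) (auto simp: BI)
    then show ?case by (simp add: algebra_simps)
  qed
  have yn: "x ^ i * v \<in> int_span B" if "v \<in> int_span ((^) y ` {..<n})" "i < m" for v i
    using that(1)
  proof (induction rule: int_span_induct_alt[consumes 1, case_names base step])
    case base
    then show ?case by (simp add: int_span_zero)
  next
    case (step c v w)
    then obtain j where "j < n" "v = y ^ j" by auto
    then have "of_int c * (x ^ i * v) + x ^ i * w \<in> int_span B"
      using step that(2) by (intro int_span_add int_span_scale) (auto simp: BI)
    then show ?case by (simp add: algebra_simps)
  qed
  have x: "x * b \<in> int_span B" if "b \<in> B" for b
  proof -
    from that obtain i j where ij: "i < m" "j < n" "b = x ^ i * y ^ j"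
      by (auto simp: B_def)
    then have eq: "x * b = x ^ Suc i * y ^ j" by simp
    show ?thesis
    proof (cases "Suc i < m")
      case True
      then show ?thesis using BI ij eq by metis
    next
      case False
      then have "Suc i = m" using ij by simp
      then show ?thesis using xm[OF m(2) ij(2)] eq by simp
    qed
  qed
  have y: "y * b \<in> int_span B" if "b \<in> B" for b
  proof -
    from that obtain i j where ij: "i < m" "j < n" "b = x ^ i * y ^ j"
      by (auto simp: B_def)
    then have eq: "y * b = x ^ i * y ^ Suc j" by simp
    show ?thesis
    proof (cases "Suc j < n")
      case True
      then show ?thesis using BI ij eq by metis
    next
      case False
      then have "Suc j = n" using ij by simp
      then show ?thesis using yn[OF n(2) ij(1)] eq by simp
    qed
  qed
  have B: "finite B" "1 \<in> B"
    using m(1) n(1) by (auto simp: B_def image_iff intro!: bexI[of _ "0::nat"])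
  show "algebraic_int (x + y)"
    by (rule algebraic_int_if_stable_module[OF B one_neq_zero])
       (auto simp: distrib_right intro!: int_span_add x y)
  have "x * y * b \<in> int_span B" if "b \<in> B" for b
    using int_span_mult[OF x y[OF that]] by (simp add: mult.assoc)
  then show "algebraic_int (x * y)"
    by (rule algebraic_int_if_stable_module[OF B one_neq_zero])
qed

section \<open>Towers of quadratic extensions inside the complex numbers\<close>

text \<open>Closure under \<open>inverse\<close> can be asked at 0 too, since
  \<open>inverse 0 = 0\<close>. The rationals supply 0, 1 and -1, from which negation, subtraction
  and division follow.\<close>

definition number_subfield :: "complex set \<Rightarrow> bool" where
  "number_subfield K \<longleftrightarrow> \<rat> \<subseteq> K \<and> (\<forall>x\<in>K. \<forall>y\<in>K. x + y \<in> K \<and> x * y \<in> K) \<and> (\<forall>x\<in>K. inverse x \<in> K)"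

lemma number_subfieldD:
  assumes "number_subfield K"
  shows "q \<in> \<rat> \<Longrightarrow> q \<in> K" "x \<in> K \<Longrightarrow> y \<in> K \<Longrightarrow> x + y \<in> K" "x \<in> K \<Longrightarrow> y \<in> K \<Longrightarrow> x * y \<in> K"
    "x \<in> K \<Longrightarrow> inverse x \<in> K" "x \<in> K \<Longrightarrow> - x \<in> K" "x \<in> K \<Longrightarrow> y \<in> K \<Longrightarrow> x - y \<in> K"
    "x \<in> K \<Longrightarrow> y \<in> K \<Longrightarrow> x / y \<in> K" "x \<in> K \<Longrightarrow> x ^ n \<in> K"
proof -
  have *: "\<rat> \<subseteq> K" "\<And>x y. x \<in> K \<Longrightarrow> y \<in> K \<Longrightarrow> x + y \<in> K" "\<And>x y. x \<in> K \<Longrightarrow> y \<in> K \<Longrightarrow> x * y \<in> K"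
    "\<And>x. x \<in> K \<Longrightarrow> inverse x \<in> K"
    using assms by (auto simp: number_subfield_def)
  have m: "- x \<in> K" if "x \<in> K" for x
    using *(3)[of "-1" x] subsetD[OF *(1), of "-1"] that by simp
  show "q \<in> \<rat> \<Longrightarrow> q \<in> K" "x \<in> K \<Longrightarrow> y \<in> K \<Longrightarrow> x + y \<in> K" "x \<in> K \<Longrightarrow> y \<in> K \<Longrightarrow> x * y \<in> K"
    "x \<in> K \<Longrightarrow> inverse x \<in> K" "x \<in> K \<Longrightarrow> - x \<in> K"
    using * m by auto
  show "x \<in> K \<Longrightarrow> y \<in> K \<Longrightarrow> x - y \<in> K"
    using *(2)[of x "- y"] m by simp
  show "x \<in> K \<Longrightarrow> y \<in> K \<Longrightarrow> x / y \<in> K"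
    using * by (simp add: divide_inverse)
  show "x \<in> K \<Longrightarrow> x ^ n \<in> K"
    using * by (induction n) auto
qed

lemma number_subfield_Rats: "number_subfield \<rat>"
  by (auto simp: number_subfield_def)

lemma ring_of_type_algebra_complex:
  "carrier (ring_of_type_algebra :: complex ring) = UNIV"
  "x \<otimes>\<^bsub>ring_of_type_algebra\<^esub> y = x * (y :: complex)"
  "x \<oplus>\<^bsub>ring_of_type_algebra\<^esub> y = x + (y :: complex)"
  "\<one>\<^bsub>ring_of_type_algebra\<^esub> = (1 :: complex)"
  "\<zero>\<^bsub>ring_of_type_algebra\<^esub> = (0 :: complex)"
  by (simp_all add: ring_of_type_algebra_def)

lemma ring_of_type_algebra_complex_inverse:
  "\<ominus>\<^bsub>ring_of_type_algebra\<^esub> x = - (x :: complex)"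
  "x \<noteq> 0 \<Longrightarrow> inv\<^bsub>ring_of_type_algebra\<^esub> x = inverse (x :: complex)"
proof -
  interpret R: Ring.field "ring_of_type_algebra :: complex ring"
    by (rule field_from_type_algebra)
  show "\<ominus>\<^bsub>ring_of_type_algebra\<^esub> x = - x"
    by (rule R.minus_equality) (simp_all add: ring_of_type_algebra_complex)
  show "inv\<^bsub>ring_of_type_algebra\<^esub> x = inverse x" if "x \<noteq> 0"
    by (rule R.inv_unique'[symmetric]) (use that in \<open>simp_all add: ring_of_type_algebra_complex\<close>)
qed

lemma rat_adjoin_superset: "S \<subseteq> rat_adjoin S"
  unfolding rat_adjoin_def by (auto intro: generate_field.incl)

lemma number_subfield_rat_adjoin: "number_subfield (rat_adjoin S)"
proof -
  note intros = generate_field.intros[where R = ring_of_type_algebra and H = "\<rat> \<union> S",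
      unfolded ring_of_type_algebra_complex ring_of_type_algebra_complex_inverse, folded rat_adjoin_def]
  have "inverse x \<in> rat_adjoin S" if "x \<in> rat_adjoin S" for x
  proof (cases "x = 0")
    case False
    then show ?thesis
      using generate_field.m_inv[of x ring_of_type_algebra "\<rat> \<union> S"] that
      by (simp add: ring_of_type_algebra_complex ring_of_type_algebra_complex_inverse rat_adjoin_def)
  qed (use that in auto)
  then show ?thesis
    using intros by (auto simp: number_subfield_def)
qed

lemma rat_adjoin_least:
  assumes "number_subfield K" "S \<subseteq> K"
  shows "rat_adjoin S \<subseteq> K"
proof
  fix x assume "x \<in> rat_adjoin S"
  then have "x \<in> generate_field ring_of_type_algebra (\<rat> \<union> S)"
    by (simp add: rat_adjoin_def)
  then show "x \<in> K"
  proof induction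
    case (incl h)
    then show ?case using assms(2) number_subfieldD(1)[OF assms(1)] by auto
  qed (auto simp: ring_of_type_algebra_complex ring_of_type_algebra_complex_inverse
      intro: number_subfieldD[OF assms(1)])
qed

text \<open>Intended for \<open>z\<close> with square in the field \<open>L\<close>; it is then the
  field L(z), and equals \<open>L\<close> when \<open>z\<close> already lies in
  \<open>L\<close>.\<close>

definition quad_ext :: "complex set \<Rightarrow> complex \<Rightarrow> complex set" where
  "quad_ext L z = {x + y * z | x y. x \<in> L \<and> y \<in> L}"

lemma quad_extI: "x \<in> L \<Longrightarrow> y \<in> L \<Longrightarrow> w = x + y * z \<Longrightarrow> w \<in> quad_ext L z"
  by (auto simp: quad_ext_def)

lemma quad_ext_least:
  assumes "number_subfield K" "L \<subseteq> K" "z \<in> K"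
  shows "quad_ext L z \<subseteq> K"
  using assms(2,3) by (auto simp: quad_ext_def intro!: number_subfieldD(2,3)[OF assms(1)])

lemma quad_ext_superset:
  assumes "number_subfield L"
  shows "L \<subseteq> quad_ext L z" "z \<in> quad_ext L z"
  using number_subfieldD(1)[OF assms, of 0] number_subfieldD(1)[OF assms, of 1]
  by (auto intro: quad_extI[of _ _ 0] quad_extI[of 0 _ 1])

lemma quad_ext_coords:
  assumes L: "number_subfield L" and z: "z \<notin> L"
    and in_L: "x \<in> L" "y \<in> L" "x' \<in> L" "y' \<in> L" and eq: "x + y * z = x' + y' * z"
  shows "x = x'" "y = y'"
proof -
  show "y = y'"
  proof (rule ccontr)
    assume "y \<noteq> y'"
    then have "z = (x' - x) / (y - y')"
      using eq by (simp add: field_simps)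
    then show False
      using z in_L by (auto intro!: number_subfieldD(6,7)[OF L])
  qed
  then show "x = x'" using eq by simp
qed

text \<open>Inverses come from rationalising the denominator:
  \<open>(x + y * z) * (x - y * z)\<close> lies in \<open>L\<close>, and the second factor is
  nonzero by uniqueness of coordinates.\<close>

lemma number_subfield_quad_ext:
  assumes L: "number_subfield L" and z2: "z\<^sup>2 \<in> L"
  shows "number_subfield (quad_ext L z)"
proof (cases "z \<in> L")
  case True
  then have "quad_ext L z = L"
    using quad_ext_least[OF L subset_refl True] quad_ext_superset[OF L] by auto
  then show ?thesis using L by simp
next
  case False
  note LD = number_subfieldD[OF L]
  show ?thesis
    unfolding number_subfield_def
  proof (intro conjI ballI)
    show "\<rat> \<subseteq> quad_ext L z"
      using quad_ext_superset(1)[OF L] LD(1) by blast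
  next
    fix u v assume "u \<in> quad_ext L z" "v \<in> quad_ext L z"
    then obtain x y x' y' where [simp]: "u = x + y * z" "v = x' + y' * z"
      and in_L: "x \<in> L" "y \<in> L" "x' \<in> L" "y' \<in> L"
      by (auto simp: quad_ext_def)
    show "u + v \<in> quad_ext L z"
      by (rule quad_extI[of "x + x'" _ "y + y'"]) (use in_L in \<open>auto simp: algebra_simps intro!: LD(2)\<close>)
    show "u * v \<in> quad_ext L z"
      by (rule quad_extI[of "x * x' + y * y' * z\<^sup>2" _ "x * y' + y * x'"])
        (use in_L z2 in \<open>auto simp: algebra_simps power2_eq_square intro!: LD(2,3)\<close>)
  next
    fix u assume "u \<in> quad_ext L z"
    then obtain x y where u: "u = x + y * z" and in_L: "x \<in> L" "y \<in> L"
      by (auto simp: quad_ext_def)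
    define n where "n = x\<^sup>2 - y\<^sup>2 * z\<^sup>2"
    have n: "n \<in> L" using in_L z2 by (auto simp: n_def intro!: LD(3,6,8))
    have n_eq: "n = (x + y * z) * (x - y * z)"
      by (simp add: n_def power2_eq_square algebra_simps)
    show "inverse u \<in> quad_ext L z"
    proof (cases "u = 0")
      case True
      then show ?thesis
        using quad_ext_superset(1)[OF L, of z] LD(1)[of 0] by auto
    next
      case nz: False
      have "x - y * z \<noteq> 0"
      proof
        assume "x - y * z = 0"
        then have "x + (- y) * z = 0 + 0 * z" by simp
        from quad_ext_coords[OF L False _ _ _ _ this] in_L LD(1)[of 0] LD(5)
        have "x = 0" "- y = 0" by auto
        with nz u show False by simp
      qed
      moreover have "n = u * (x - y * z)" by (simp add: n_eq u)
      ultimately have "inverse u = (x - y * z) / n"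
        using nz by (simp add: divide_inverse)
      then show ?thesis
        by (intro quad_extI[of "x / n" _ "- y / n"])
          (use in_L n in \<open>auto simp: diff_divide_distrib intro!: LD(5,7)\<close>)
    qed
  qed
qed

section \<open>Embeddings of number fields into the complex numbers and their extension\<close>

definition number_field_hom :: "complex set \<Rightarrow> (complex \<Rightarrow> complex) \<Rightarrow> bool" where
  "number_field_hom L \<tau> \<longleftrightarrow> (\<forall>q\<in>\<rat>. \<tau> q = q) \<and>
     (\<forall>x\<in>L. \<forall>y\<in>L. \<tau> (x + y) = \<tau> x + \<tau> y \<and> \<tau> (x * y) = \<tau> x * \<tau> y)"

lemma number_field_homD:
  assumes "number_field_hom L \<tau>" 
  shows "q \<in> \<rat> \<Longrightarrow> \<tau> q = q" "x \<in> L \<Longrightarrow> y \<in> L \<Longrightarrow> \<tau> (x + y) = \<tau> x + \<tau> y"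
    "x \<in> L \<Longrightarrow> y \<in> L \<Longrightarrow> \<tau> (x * y) = \<tau> x * \<tau> y"
  using assms by (auto simp: number_field_hom_def)

lemma number_field_hom_simps:
  assumes h: "number_field_hom L \<tau>" and L: "number_subfield L"
  shows "x \<in> L \<Longrightarrow> \<tau> (- x) = - \<tau> x" "x \<in> L \<Longrightarrow> y \<in> L \<Longrightarrow> \<tau> (x - y) = \<tau> x - \<tau> y"
    "x \<in> L \<Longrightarrow> \<tau> (x ^ n) = \<tau> x ^ n" "x \<in> L \<Longrightarrow> \<tau> (inverse x) = inverse (\<tau> x)"
    "x \<in> L \<Longrightarrow> \<tau> x = 0 \<Longrightarrow> x = 0"
proof -
  note hD = number_field_homD[OF h] and LD = number_subfieldD[OF L]
  have m: "\<tau> (- x) = - \<tau> x" if "x \<in> L" for x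
    using hD(2)[of x "- x"] hD(1)[of 0] that LD(5) by (simp add: eq_neg_iff_add_eq_0 add.commute)
  show "x \<in> L \<Longrightarrow> \<tau> (- x) = - \<tau> x" by (rule m)
  show "x \<in> L \<Longrightarrow> y \<in> L \<Longrightarrow> \<tau> (x - y) = \<tau> x - \<tau> y"
    using hD(2)[of x "- y"] m LD(5) by simp
  show "x \<in> L \<Longrightarrow> \<tau> (x ^ n) = \<tau> x ^ n"
    by (induction n) (auto simp: hD LD)
  have i: "\<tau> x * \<tau> (inverse x) = 1" if "x \<in> L" "x \<noteq> 0" for x
    using hD(3)[of x "inverse x"] hD(1)[of 1] that LD(4) by simp
  show "x \<in> L \<Longrightarrow> \<tau> x = 0 \<Longrightarrow> x = 0"
    using i[of x] by auto
  show "x \<in> L \<Longrightarrow> \<tau> (inverse x) = inverse (\<tau> x)"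
    using i[of x] hD(1)[of 0] by (cases "x = 0") (auto simp: inverse_unique)
qed

lemma number_field_hom_inj:
  assumes h: "number_field_hom L \<tau>" and L: "number_subfield L"
  shows "inj_on \<tau> L"
proof (rule inj_onI)
  fix x y assume "x \<in> L" "y \<in> L" "\<tau> x = \<tau> y"
  then have "x - y \<in> L" "\<tau> (x - y) = 0"
    using number_field_hom_simps(2)[OF h L] number_subfieldD(6)[OF L] by auto
  then have "x - y = 0" using number_field_hom_simps(5)[OF h L] by blast
  then show "x = y" by simp
qed

lemma number_subfield_image:
  assumes h: "number_field_hom L \<tau>" and L: "number_subfield L"
  shows "number_subfield (\<tau> ` L)"
  unfolding number_subfield_def
proof (intro conjI ballI)
  show "\<rat> \<subseteq> \<tau> ` L"
    using number_field_homD(1)[OF h] number_subfieldD(1)[OF L] by (metis image_eqI subsetI)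
next
  fix u v assume "u \<in> \<tau> ` L" "v \<in> \<tau> ` L"
  then show "u + v \<in> \<tau> ` L" "u * v \<in> \<tau> ` L"
    using number_field_homD(2,3)[OF h, symmetric] number_subfieldD(2,3)[OF L] by (auto intro!: imageI)
next
  fix u assume "u \<in> \<tau> ` L"
  then show "inverse u \<in> \<tau> ` L"
    using number_field_hom_simps(4)[OF h L, symmetric] number_subfieldD(4)[OF L] by (auto intro!: imageI)
qed

text \<open>The basic tool for producing automorphisms: since \<open>z\<close> is not in
  \<open>L\<close>, coordinates over \<open>L\<close> are unique, so either square root of
  \<open>\<tau> (z\<^sup>2)\<close> may be prescribed as the image of \<open>z\<close>.\<close>

lemma number_field_hom_extend:
  assumes h: "number_field_hom L \<tau>" and L: "number_subfield L"
    and z: "z \<notin> L" "z\<^sup>2 \<in> L" and w: "w\<^sup>2 = \<tau> (z\<^sup>2)"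
  obtains \<tau>' where "number_field_hom (quad_ext L z) \<tau>'" "\<And>x. x \<in> L \<Longrightarrow> \<tau>' x = \<tau> x" "\<tau>' z = w"
proof -
  note hD = number_field_homD[OF h] and LD = number_subfieldD[OF L]
  define \<tau>' where "\<tau>' = (\<lambda>u. THE v. \<exists>x\<in>L. \<exists>y\<in>L. u = x + y * z \<and> v = \<tau> x + \<tau> y * w)"
  have \<tau>': "\<tau>' (x + y * z) = \<tau> x + \<tau> y * w" if "x \<in> L" "y \<in> L" for x y
    unfolding \<tau>'_def
  proof (rule the_equality)
    fix v assume "\<exists>x'\<in>L. \<exists>y'\<in>L. x + y * z = x' + y' * z \<and> v = \<tau> x' + \<tau> y' * w"
    then obtain x' y' where *: "x' \<in> L" "y' \<in> L" "x + y * z = x' + y' * z" "v = \<tau> x' + \<tau> y' * w"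
      by blast
    then show "v = \<tau> x + \<tau> y * w"
      using quad_ext_coords[OF L z(1) that *(1,2,3)] by simp
  qed (use that in auto)
  have ext: "\<tau>' x = \<tau> x" if "x \<in> L" for x
    using \<tau>'[of x 0] that LD(1)[of 0] hD(1)[of 0] by simp
  show thesis
  proof (rule that[OF _ ext])
    show "\<tau>' z = w"
      using \<tau>'[of 0 1] LD(1)[of 0] LD(1)[of 1] hD(1)[of 0] hD(1)[of 1] by simp
    show "number_field_hom (quad_ext L z) \<tau>'"
      unfolding number_field_hom_def
    proof (intro conjI ballI)
      show "\<tau>' q = q" if "q \<in> \<rat>" for q
        using ext hD(1) LD(1) that by simp
    next
      fix u v assume "u \<in> quad_ext L z" "v \<in> quad_ext L z"
      then obtain x y x' y' where uv: "u = x + y * z" "v = x' + y' * z"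
        and in_L: "x \<in> L" "y \<in> L" "x' \<in> L" "y' \<in> L"
        by (auto simp: quad_ext_def)
      have "u + v = (x + x') + (y + y') * z"
        using uv by (simp add: algebra_simps)
      then show "\<tau>' (u + v) = \<tau>' u + \<tau>' v"
        using in_L \<tau>'[of "x + x'" "y + y'"] by (simp add: uv \<tau>' LD(2) hD(2) algebra_simps)
      have "u * v = (x * x' + y * y' * z\<^sup>2) + (x * y' + y * x') * z"
        using uv by (simp add: algebra_simps power2_eq_square)
      then have "\<tau>' (u * v) = \<tau> (x * x' + y * y' * z\<^sup>2) + \<tau> (x * y' + y * x') * w"
        using in_L z(2) by (simp add: \<tau>' LD(2,3))
      also have "\<dots> = (\<tau> x * \<tau> x' + \<tau> y * \<tau> y' * w\<^sup>2) + (\<tau> x * \<tau> y' + \<tau> y * \<tau> x') * w"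
        using in_L z(2) by (simp add: hD LD w)
      also have "\<dots> = \<tau>' u * \<tau>' v"
        using in_L by (simp add: uv \<tau>' power2_eq_square algebra_simps)
      finally show "\<tau>' (u * v) = \<tau>' u * \<tau>' v" .
    qed
  qed
qed

lemma number_field_hom_poly:
  assumes h: "number_field_hom L \<tau>" and L: "number_subfield L" and z: "z \<in> L"
  shows "\<tau> (poly (map_poly of_int p) z) = poly (map_poly of_int p) (\<tau> z)"
    and "poly (map_poly of_int p) z \<in> L"
proof -
  have "\<tau> (poly (map_poly of_int p) z) = poly (map_poly of_int p) (\<tau> z) \<and>
        poly (map_poly of_int p) z \<in> L"
    by (induction p)
      (use z in \<open>auto simp: number_field_homD[OF h] number_subfieldD[OF L] map_poly_pCons\<close>)
  then show "\<tau> (poly (map_poly of_int p) z) = poly (map_poly of_int p) (\<tau> z)"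
    "poly (map_poly of_int p) z \<in> L" by auto
qed

lemma algebraic_int_hom:
  assumes h: "number_field_hom L \<tau>" and L: "number_subfield L" and "z \<in> L" "algebraic_int z"
  shows "algebraic_int (\<tau> z)"
proof -
  obtain p :: "int poly" where p: "poly (map_poly of_int p) z = 0" "lead_coeff p = 1"
    using assms(4) by (auto simp: algebraic_int_altdef_ipoly)
  then have "poly (map_poly of_int p) (\<tau> z) = 0"
    using number_field_hom_poly(1)[OF h L assms(3), of p] number_field_homD(1)[OF h, of 0] by simp
  with p(2) show ?thesis by (auto simp: algebraic_int_altdef_ipoly)
qed

locale irreducible_biquadratic =
  fixes a b :: int and \<theta> :: complex
  assumes irred: "Factorial_Ring.irreducible (map_poly rat_of_int [:b, 0, a, 0, 1:])"
    and root: "\<theta> ^ 4 + of_int a * \<theta>\<^sup>2 + of_int b = 0"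
begin

text \<open>A nonzero polynomial \<open>P\<close> of degree at most 3 is coprime to the irreducible
  quartic \<open>F\<close>; if \<open>P\<close> vanished at \<theta>, evaluating a Bezout identity
  there would give 0 = 1.\<close>

lemma powers_independent:
  assumes "c0 \<in> \<rat>" "c1 \<in> \<rat>" "c2 \<in> \<rat>" "c3 \<in> \<rat>"
    and eq: "c0 + c1 * \<theta> + c2 * \<theta>\<^sup>2 + c3 * \<theta> ^ 3 = 0"
  shows "c0 = 0 \<and> c1 = 0 \<and> c2 = 0 \<and> c3 = 0"
proof -
  obtain r0 r1 r2 r3 where r: "c0 = of_rat r0" "c1 = of_rat r1" "c2 = of_rat r2" "c3 = of_rat r3"
    using assms(1-4) by (auto simp: Rats_def)
  define F where "F = map_poly rat_of_int [:b, 0, a, 0, 1:]"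
  have F: "F = [:of_int b, 0, of_int a, 0, 1:]" by (simp add: F_def map_poly_pCons)
  define P where "P = [:r0, r1, r2, r3:]"
  interpret map_hom: map_poly_comm_ring_hom "of_rat :: rat \<Rightarrow> complex" ..
  define ev where "ev p = poly (map_poly of_rat p) \<theta>" for p
  have ev_mult: "ev (p * q) = ev p * ev q" and ev_add: "ev (p + q) = ev p + ev q" for p q
    by (simp_all add: ev_def map_hom.hom_mult map_hom.hom_add)
  have evF: "ev F = 0" using root
    by (simp add: ev_def F map_poly_pCons algebra_simps power2_eq_square power4_eq_xxxx)
  have evP: "ev P = 0" using eq
    by (simp add: ev_def P_def r of_rat_hom.map_poly_pCons_hom algebra_simps power2_eq_square power3_eq_cube)
  have "P = 0"
  proof (rule ccontr)
    assume nz: "P \<noteq> 0"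
    have "Polynomial.degree P \<le> 3" by (simp add: P_def)
    moreover have "Polynomial.degree F = 4" by (simp add: F)
    ultimately have "\<not> F dvd P" using nz by (auto dest: dvd_imp_degree_le)
    moreover have "prime_elem F" using irred unfolding F_def[symmetric]
      by (rule irreducible_imp_prime_elem_gcd)
    ultimately have "coprime F P" using prime_elem_imp_coprime by blast
    then obtain u v where "u * F + v * P = 1"
      using bezout_coefficients_fst_snd[of F P] by (auto simp: coprime_iff_gcd_eq_1)
    then have "ev 1 = 0" using ev_mult ev_add evF evP by (metis add_0 mult_zero_right)
    then show False by (simp add: ev_def)
  qed
  then show ?thesis by (simp add: P_def r)
qed

end

section \<open>Arithmetic of the relative norm\<close>

text \<open>Conjugation is the extension of the identity of \<open>L\<close> that sends
  \<open>z\<close> to \<open>- z\<close>, and embeddings preserve monic integer equations.\<close>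

lemma quad_conj_algebraic_int:
  assumes L: "number_subfield L" and z: "z \<notin> L" "z\<^sup>2 \<in> L"
    and xy: "x \<in> L" "y \<in> L" "algebraic_int (x + y * z)"
  shows "algebraic_int (x - y * z)"
proof -
  have "number_field_hom L (\<lambda>x. x)" by (simp add: number_field_hom_def)
  then obtain \<tau> where \<tau>: "number_field_hom (quad_ext L z) \<tau>" "\<And>x. x \<in> L \<Longrightarrow> \<tau> x = x" "\<tau> z = - z"
    using number_field_hom_extend[OF _ L z, of "\<lambda>x. x" "- z"] by (metis power2_minus)
  have Q: "number_subfield (quad_ext L z)" by (rule number_subfield_quad_ext[OF L z(2)])
  have mem: "x \<in> quad_ext L z" "y \<in> quad_ext L z" "z \<in> quad_ext L z"
    using quad_ext_superset[OF L, of z] xy by auto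
  then have "\<tau> (x + y * z) = x - y * z"
    using \<tau>(2,3) xy by (simp add: number_field_homD[OF \<tau>(1)] number_subfieldD(3)[OF Q])
  then show ?thesis
    using algebraic_int_hom[OF \<tau>(1) Q _ xy(3)] number_subfieldD(2,3)[OF Q] mem by simp
qed

lemma algebraic_int_of_int [simp]: "algebraic_int (of_int k :: complex)"
  by (rule int_imp_algebraic_int) simp

lemma algebraic_int_diff: "algebraic_int x \<Longrightarrow> algebraic_int y \<Longrightarrow> algebraic_int (x - y :: complex)"
  using algebraic_int_add_mult(1)[of x "- y"] by simp

lemma algebraic_int_sqrtD: "algebraic_int ((x :: complex)\<^sup>2) \<Longrightarrow> algebraic_int x"
  by (rule algebraic_int_root[where p = "[:0, 0, 1:]"])
    (auto simp: power2_eq_square coeff_pCons split: nat.splits)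

lemma of_int_divide_in_Ints_dvd:
  assumes "(of_int k / of_int m :: complex) \<in> \<int>" "m \<noteq> 0"
  shows "m dvd k"
proof -
  obtain j where "(of_int k / of_int m :: complex) = of_int j"
    using assms(1) by (auto elim: Ints_cases)
  then have "(of_int k :: complex) = of_int (m * j)"
    using assms(2) by (simp add: field_simps)
  then have "k = m * j" by (simp only: of_int_eq_iff)
  then show ?thesis by simp
qed

text \<open>If \<open>q\<close> is the reduced denominator of \<open>y\<close>, integrality forces
  \<open>q\<^sup>2\<close> to divide \<open>w\<close>.\<close>

lemma squarefree_mult_square_in_Ints:
  fixes w :: int and y :: complex
  assumes "squarefree w" "y \<in> \<rat>" "of_int w * y\<^sup>2 \<in> \<int>"
  shows "y \<in> \<int>"
proof -
  obtain p q where q: "q > 0" "coprime p q" "y = of_int p / of_int q"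
    using assms(2) by (elim Rats_cases')
  then have "(of_int (w * p\<^sup>2) / of_int (q\<^sup>2) :: complex) \<in> \<int>"
    using assms(3) by (simp add: power_divide)
  then have "q\<^sup>2 dvd w * p\<^sup>2" using of_int_divide_in_Ints_dvd q(1) by simp
  then have "q\<^sup>2 dvd w" using q(2)
    by (simp add: coprime_commute coprime_dvd_mult_left_iff)
  then have "q dvd 1" using assms(1) by (auto simp: squarefree_def)
  then have "q = 1" using q(1) by simp
  then show ?thesis using q by simp
qed

text \<open>The condition says that \<open>\<int>[\<phi>]\<close> is the full ring of integers of \<open>\<rat>(\<phi>)\<close>.\<close>

definition quadratic_maximal :: "int \<Rightarrow> int \<Rightarrow> bool" where
  "quadratic_maximal a b \<longleftrightarrow>
     (if even a then squarefree ((a div 2)\<^sup>2 - b) \<and> ((a div 2)\<^sup>2 - b) mod 4 \<in> {2, 3}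
      else squarefree (a\<^sup>2 - 4 * b))"

definition biquadratic_residues :: "(int \<times> int) set" where
  "biquadratic_residues = {(0,1), (0,2), (2,2), (2,3), (1,3), (3,2), (3,1), (3,3)}"

lemma int_square_mod_4: "(x :: int)\<^sup>2 mod 4 = (if even x then 0 else 1)"
proof (cases "even x")
  case True
  then obtain k where "x = 2 * k" ..
  then show ?thesis by (simp add: power_mult_distrib)
next
  case False
  then obtain k where "x = 2 * k + 1" by (elim oddE)
  then have "x\<^sup>2 mod 4 = (1 + 4 * (k\<^sup>2 + k)) mod 4" by (simp add: power2_eq_square algebra_simps)
  also have "\<dots> = 1" by (subst mod_mult_self2) simp
  finally show ?thesis using False by simp
qed

text \<open>For odd \<open>y\<close> the square of \<open>t\<close> would be congruent to
  \<open>w\<close> modulo 4, but 2 and 3 are not squares there. It removes the last factor 2 from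
  the denominator in the quadratic field.\<close>

lemma dvd_4_if_odd:
  fixes w t y :: int
  assumes "w mod 4 \<in> {2, 3}" "4 dvd t\<^sup>2 - w * y\<^sup>2"
  shows "even y"
proof (rule ccontr)
  assume "odd y"
  have "t\<^sup>2 mod 4 = (w * y\<^sup>2) mod 4"
    using assms(2) by (simp add: mod_eq_dvd_iff)
  also have "\<dots> = ((w mod 4) * (y\<^sup>2 mod 4)) mod 4" by (simp add: mod_simps)
  also have "\<dots> = w mod 4" using \<open>odd y\<close> by (simp add: int_square_mod_4)
  finally show False using assms(1) by (auto simp: int_square_mod_4 split: if_splits)
qed

text \<open>The coordinates of \<open>A\<^sup>2 - \<phi> B\<^sup>2\<close> with respect to \<open>1, \<phi>\<close>, where \<open>A = c0 + c2 \<phi>\<close>, \<open>B = c1 + c3 \<phi>\<close>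
  and \<open>\<phi>\<^sup>2 = - a \<phi> - b\<close>.\<close>

definition norm_coord0 :: "int \<Rightarrow> int \<Rightarrow> int \<Rightarrow> int \<Rightarrow> int \<Rightarrow> int \<Rightarrow> int" where
  "norm_coord0 a b c0 c1 c2 c3 = c0\<^sup>2 - b * c2\<^sup>2 + 2 * b * (c1 * c3) - a * b * c3\<^sup>2"

definition norm_coord1 :: "int \<Rightarrow> int \<Rightarrow> int \<Rightarrow> int \<Rightarrow> int \<Rightarrow> int \<Rightarrow> int" where
  "norm_coord1 a b c0 c1 c2 c3 =
     2 * (c0 * c2) - a * c2\<^sup>2 - c1\<^sup>2 + 2 * a * (c1 * c3) - (a\<^sup>2 - b) * c3\<^sup>2"

text \<open>With B = c1 + c3 \<phi>, the hypotheses \<open>d\<close> say that \<open>p\<close>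
  divides both coordinates of \<phi> B. This settles the case where \<open>p\<close> does not divide
  \<open>b\<close>. Otherwise \<open>p\<close> divides \<open>b\<close> exactly once, so it suffices
  that \<open>p\<^sup>2\<close> divides \<open>b * c3\<^sup>2\<close>; this is read off from the
  first norm coordinate if \<open>p\<close> does not divide \<open>a\<close>, and from the second if
  it does.\<close>

lemma dvd_of_norm_coords:
  fixes a b p :: int
  assumes p: "prime p" and b: "squarefree b"
    and c02: "p dvd c0" "p dvd c2"
    and n: "p\<^sup>2 dvd norm_coord0 a b c0 c1 c2 c3" "p\<^sup>2 dvd norm_coord1 a b c0 c1 c2 c3"
    and d: "p dvd c1 - a * c3" "p dvd b * c3"
  shows "p dvd c1 \<and> p dvd c3"
proof -
  have c3: "p dvd c3" if h: "p\<^sup>2 dvd b * c3\<^sup>2" "p dvd b"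
  proof -
    obtain b' where b': "b = p * b'" using h(2) ..
    have "\<not> p dvd b'"
    proof
      assume "p dvd b'"
      then have "p\<^sup>2 dvd b" by (auto simp: b' power2_eq_square)
      then have "p dvd 1" using b by (auto simp: squarefree_def)
      then show False using p not_prime_unit by blast
    qed
    moreover have "p dvd b' * c3\<^sup>2"
      using h(1) p by (auto simp: b' power2_eq_square mult.assoc)
    ultimately show ?thesis
      using p by (metis prime_dvd_mult_iff prime_dvd_power_iff zero_less_numeral)
  qed
  have sq: "p\<^sup>2 dvd x * y" if "p dvd x" "p dvd y" for x y
    using that mult_dvd_mono by (auto simp: power2_eq_square)
  have "p dvd c3"
  proof (cases "p dvd b")
    case False
    then show ?thesis using d(2) p by (simp add: prime_dvd_mult_iff)
  next
    case pb: True
    show ?thesis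
    proof (cases "p dvd a")
      case False
      \<comment> \<open>The mixed term \<open>2 * b * (c1 * c3)\<close> need not vanish modulo
        \<open>p\<^sup>2\<close>; since \<open>p\<close> divides \<open>b\<close>, replacing
        \<open>c1\<close> by \<open>a * c3\<close> in it is allowed and turns
        \<open>- a * b * c3\<^sup>2\<close> into its negative.\<close>
      have "a * (b * c3\<^sup>2) = norm_coord0 a b c0 c1 c2 c3 - c0 * c0 + c2 * c2 * b - 2 * c3 * (b * (c1 - a * c3))"
        by (simp add: norm_coord0_def power2_eq_square algebra_simps)
      moreover have "p\<^sup>2 dvd \<dots>"
        by (intro dvd_diff dvd_add n(1) sq c02 dvd_mult2[OF sq[OF c02(2) c02(2)]] dvd_mult[OF sq[OF pb d(1)]])
      ultimately have "p\<^sup>2 dvd a * (b * c3\<^sup>2)" by simp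
      moreover have "coprime (p\<^sup>2) a" using False p by (simp add: prime_imp_coprime)
      ultimately show ?thesis using c3 pb by (simp add: coprime_dvd_mult_right_iff)
    next
      case pa: True
      then have pc1: "p dvd c1" using dvd_add[OF d(1) dvd_mult2[OF pa, of c3]] by simp
      have "b * c3\<^sup>2 = norm_coord1 a b c0 c1 c2 c3 - 2 * (c0 * c2) + a * (c2 * c2) + c1 * c1
          - 2 * c3 * (a * c1) + c3 * c3 * (a * a)"
        by (simp add: norm_coord1_def power2_eq_square algebra_simps)
      moreover have "p\<^sup>2 dvd \<dots>"
        by (intro dvd_diff dvd_add n(2) dvd_mult sq c02 pa pc1)
      ultimately show ?thesis using c3 pb by simp
    qed
  qed
  then show ?thesis using dvd_add[OF d(1) dvd_mult[of p c3 a]] by simp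
qed

text \<open>The \<open>c\<^sub>i\<close> enter only through their squares and doubled products, so modulo 4 only their
  parity matters.\<close>

lemma cong_mod_4_norm_coords:
  fixes a b a' b' :: int
  assumes "a mod 4 = a' mod 4" "b mod 4 = b' mod 4"
    and "\<And>i. e i = c i mod (2 :: int)"
  shows "norm_coord0 a b (c 0) (c 1) (c 2) (c (3::nat)) mod 4 = norm_coord0 a' b' (e 0) (e 1) (e 2) (e 3) mod 4"
    and "norm_coord1 a b (c 0) (c 1) (c 2) (c 3) mod 4 = norm_coord1 a' b' (e 0) (e 1) (e 2) (e 3) mod 4"
proof -
  have sq: "(c i)\<^sup>2 mod 4 = (e i)\<^sup>2 mod 4" for i
    by (auto simp: int_square_mod_4 assms(3))
  have pr: "(2 * (c i * c j)) mod 4 = (2 * (e i * e j)) mod 4" for i j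
  proof -
    have "(c i * c j) mod 2 = (e i * e j) mod 2" by (simp add: assms(3) mod_simps)
    then show ?thesis by (metis mult_mod_right num_double numeral_times_numeral)
  qed
  have asq: "a\<^sup>2 mod 4 = a'\<^sup>2 mod 4" using assms(1) by (metis power_mod)
  \<comment> \<open>\<open>t\<close> keeps each doubled product in one piece: its separate factors
    are not determined modulo 4 by their parities.\<close>
  define t where "t f i j = 2 * (f i * f j)" for f :: "nat \<Rightarrow> int" and i j
  have pr: "t c i j mod 4 = t e i j mod 4" for i j using pr by (simp add: t_def)
  have F: "[a = a'] (mod 4)" "[b = b'] (mod 4)" "[a\<^sup>2 = a'\<^sup>2] (mod 4)"
    "[(c i)\<^sup>2 = (e i)\<^sup>2] (mod 4)" "[t c i j = t e i j] (mod 4)" for i j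
    unfolding cong_def by (fact assms asq sq pr)+
  have "[norm_coord0 a b (c 0) (c 1) (c 2) (c (3::nat)) = norm_coord0 a' b' (e 0) (e 1) (e 2) (e 3)] (mod 4)"
    unfolding norm_coord0_def mult.assoc mult.left_commute[of 2 b] mult.left_commute[of 2 b'] t_def[of c, symmetric] t_def[of e, symmetric]
    by (rule F | rule cong_add cong_diff cong_mult)+
  moreover have "[norm_coord1 a b (c 0) (c 1) (c 2) (c (3::nat)) = norm_coord1 a' b' (e 0) (e 1) (e 2) (e 3)] (mod 4)"
    unfolding norm_coord1_def mult.assoc mult.left_commute[of 2 a] mult.left_commute[of 2 a'] t_def[of c, symmetric] t_def[of e, symmetric]
    by (rule F | rule cong_add cong_diff cong_mult)+
  ultimately show "norm_coord0 a b (c 0) (c 1) (c 2) (c (3::nat)) mod 4 = norm_coord0 a' b' (e 0) (e 1) (e 2) (e 3) mod 4"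
    "norm_coord1 a b (c 0) (c 1) (c 2) (c 3) mod 4 = norm_coord1 a' b' (e 0) (e 1) (e 2) (e 3) mod 4"
    by (simp_all add: cong_def)
qed

lemma even_of_norm_coords:
  assumes R: "(a mod 4, b mod 4) \<in> biquadratic_residues"
    and n: "4 dvd norm_coord0 a b c0 c1 c2 c3" "4 dvd norm_coord1 a b c0 c1 c2 c3"
  shows "even c0 \<and> even c2"
proof -
  define c where "c i = (if i = 0 then c0 else if i = 1 then c1 else if i = 2 then c2 else c3)" for i :: nat
  define e where "e i = c i mod 2" for i
  have c: "c 0 = c0" "c 1 = c1" "c 2 = c2" "c 3 = c3" by (simp_all add: c_def)
  have e: "e i \<in> {0, 1}" for i unfolding e_def by simp presburger
  obtain a' b' where ab: "a mod 4 = a' mod 4" "b mod 4 = b' mod 4" "(a', b') \<in> biquadratic_residues"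
    using R by (metis mod_mod_trivial)
  note cong_mod_4_norm_coords[OF ab(1,2), of e c, unfolded c, OF e_def]
  then have n': "norm_coord0 a' b' (e 0) (e 1) (e 2) (e 3) mod 4 = 0" "norm_coord1 a' b' (e 0) (e 1) (e 2) (e 3) mod 4 = 0"
    using n by simp_all
  \<comment> \<open>Eight residue pairs times sixteen parity vectors. Only \<open>c0\<close> and
    \<open>c2\<close> are claimed even here; \<open>c1\<close> and \<open>c3\<close> are later
    treated uniformly in the prime.\<close>
  have "\<forall>ab\<in>biquadratic_residues. \<forall>x0\<in>{0, 1}. \<forall>x1\<in>{0, 1}. \<forall>x2\<in>{0, 1}. \<forall>x3\<in>{0, 1}.
      norm_coord0 (fst ab) (snd ab) x0 x1 x2 x3 mod 4 = 0 \<longrightarrow> norm_coord1 (fst ab) (snd ab) x0 x1 x2 x3 mod 4 = 0 \<longrightarrow> x0 = 0 \<and> x2 = 0"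
    by (simp add: biquadratic_residues_def norm_coord0_def norm_coord1_def)
  from this[THEN bspec, OF ab(3), THEN bspec, OF e[of 0], THEN bspec, OF e[of 1], THEN bspec, OF e[of 2],
      THEN bspec, OF e[of 3]] n'
  have "e 0 = 0 \<and> e 2 = 0" by simp
  then show ?thesis by (auto simp: e_def c)
qed

section \<open>Integrality in the field generated by a root\<close>

context irreducible_biquadratic
begin

definition sqrt_delta :: complex where "sqrt_delta = 2 * \<theta>\<^sup>2 + of_int a"

text \<open>This is the field generated by \<phi>, presented by a square root because the quadratic
  step requires a generator whose square lies below. Coordinates with respect to 1, \<phi> are
  recovered in \<open>base_fieldI\<close> and \<open>base_fieldE\<close>.\<close>

definition base_field :: "complex set" where "base_field = quad_ext \<rat> sqrt_delta"

lemma theta4: "\<theta> ^ 4 = - of_int a * \<theta>\<^sup>2 - of_int b"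
  using root by (simp add: algebra_simps eq_neg_iff_add_eq_0)

lemma theta_sq_sq: "\<theta>\<^sup>2 * \<theta>\<^sup>2 = - of_int a * \<theta>\<^sup>2 - of_int b"
  using theta4 by (simp add: power2_eq_square power4_eq_xxxx mult.assoc)

lemma sqrt_delta_sq: "sqrt_delta\<^sup>2 = of_int (a\<^sup>2 - 4 * b)"
proof -
  have "sqrt_delta\<^sup>2 = 4 * (\<theta>\<^sup>2 * \<theta>\<^sup>2) + 4 * of_int a * \<theta>\<^sup>2 + of_int (a\<^sup>2)"
    by (simp add: sqrt_delta_def power2_eq_square algebra_simps)
  then show ?thesis unfolding theta_sq_sq by (simp add: algebra_simps)
qed

lemma sqrt_delta_notin: "sqrt_delta \<notin> \<rat>"
proof
  assume "sqrt_delta \<in> \<rat>"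
  then have "of_int a - sqrt_delta \<in> \<rat>" by simp
  moreover have "of_int a - sqrt_delta + 0 * \<theta> + 2 * \<theta>\<^sup>2 + 0 * \<theta> ^ 3 = 0"
    by (simp add: sqrt_delta_def)
  ultimately have "(2 :: complex) = 0" using powers_independent[of _ 0 2 0] by simp
  then show False by simp
qed

lemma number_subfield_base: "number_subfield base_field"
  unfolding base_field_def using sqrt_delta_sq
  by (intro number_subfield_quad_ext number_subfield_Rats) (auto simp: Rats_of_int)

lemma base_fieldI: "x \<in> \<rat> \<Longrightarrow> y \<in> \<rat> \<Longrightarrow> x + y * \<theta>\<^sup>2 \<in> base_field"
  unfolding base_field_def
  by (rule quad_extI[of "x - y * of_int a / 2" _ "y / 2"]) (auto simp: sqrt_delta_def field_simps)

lemma base_fieldE: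
  assumes "z \<in> base_field"
  obtains x y where "x \<in> \<rat>" "y \<in> \<rat>" "z = x + y * \<theta>\<^sup>2"
proof -
  obtain x y where xy: "x \<in> \<rat>" "y \<in> \<rat>" "z = x + y * sqrt_delta"
    using assms by (auto simp: base_field_def quad_ext_def)
  show thesis
    by (rule that[of "x + y * of_int a" "2 * y"]) (use xy in \<open>auto simp: sqrt_delta_def algebra_simps\<close>)
qed

lemma theta_sq_in_base: "\<theta>\<^sup>2 \<in> base_field"
  using base_fieldI[of 0 1] by simp

lemma theta_notin: "\<theta> \<notin> base_field"
proof
  assume "\<theta> \<in> base_field"
  then obtain x y where "x \<in> \<rat>" "y \<in> \<rat>" "\<theta> = x + y * \<theta>\<^sup>2" by (elim base_fieldE)
  then show False
    using powers_independent[of x "-1" y 0] by (simp add: algebra_simps)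
qed

lemma rat_adjoin_theta: "rat_adjoin {\<theta>} = quad_ext base_field \<theta>"
proof
  have K: "number_subfield (quad_ext base_field \<theta>)"
    by (rule number_subfield_quad_ext[OF number_subfield_base theta_sq_in_base])
  show "rat_adjoin {\<theta>} \<subseteq> quad_ext base_field \<theta>"
    using quad_ext_superset(2)[OF number_subfield_base] by (intro rat_adjoin_least K) auto
  have \<theta>: "\<theta> \<in> rat_adjoin {\<theta>}" using rat_adjoin_superset by auto
  note A = number_subfield_rat_adjoin[of "{\<theta>}"]
  have "base_field \<subseteq> rat_adjoin {\<theta>}"
    using number_subfieldD(1,2,3,8)[OF A] \<theta> by (auto elim!: base_fieldE)
  then show "quad_ext base_field \<theta> \<subseteq> rat_adjoin {\<theta>}"
    by (rule quad_ext_least[OF A _ \<theta>])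
qed

lemma rat_adjoin_thetaE:
  assumes "z \<in> rat_adjoin {\<theta>}"
  obtains c0 c1 c2 c3 where "c0 \<in> \<rat>" "c1 \<in> \<rat>" "c2 \<in> \<rat>" "c3 \<in> \<rat>"
    "z = c0 + c1 * \<theta> + c2 * \<theta>\<^sup>2 + c3 * \<theta> ^ 3"
proof -
  obtain x y where "z = x + y * \<theta>" "x \<in> base_field" "y \<in> base_field"
    using assms by (auto simp: rat_adjoin_theta quad_ext_def)
  then obtain c0 c2 c1 c3 where "c0 \<in> \<rat>" "c1 \<in> \<rat>" "c2 \<in> \<rat>" "c3 \<in> \<rat>"
    "z = (c0 + c2 * \<theta>\<^sup>2) + (c1 + c3 * \<theta>\<^sup>2) * \<theta>"
    by (metis base_fieldE)
  then show thesis
    by (intro that[of c0 c1 c2 c3]) (auto simp: algebra_simps power2_eq_square power3_eq_cube)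
qed

lemma rat_adjoin_thetaI:
  assumes "c0 \<in> \<rat>" "c1 \<in> \<rat>" "c2 \<in> \<rat>" "c3 \<in> \<rat>"
  shows "c0 + c1 * \<theta> + c2 * \<theta>\<^sup>2 + c3 * \<theta> ^ 3 \<in> rat_adjoin {\<theta>}"
proof -
  note D = number_subfieldD[OF number_subfield_rat_adjoin[of "{\<theta>}"]]
  have "\<theta> \<in> rat_adjoin {\<theta>}" using rat_adjoin_superset by auto
  with assms[THEN D(1)] show ?thesis by (intro D(2,3,8))
qed

lemma algebraic_int_theta [simp]: "algebraic_int \<theta>"
proof -
  have "poly (map_poly of_int [:b, 0, a, 0, 1:]) \<theta> = 0"
    using root by (simp add: map_poly_pCons algebra_simps power2_eq_square power4_eq_xxxx)
  then show ?thesis by (auto simp: algebraic_int_altdef_ipoly intro!: exI[of _ "[:b, 0, a, 0, 1:]"])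
qed

lemma algebraic_int_theta_sq [simp]: "algebraic_int (\<theta>\<^sup>2)"
  using algebraic_int_add_mult(2)[of \<theta> \<theta>] by (simp add: power2_eq_square)

text \<open>The conjugate of \<phi> is \<open>- of_int a\<close> - \<phi>, the other root of t^2 + a
  t + b.\<close>

lemma base_conj_algebraic_int:
  assumes "x \<in> \<rat>" "y \<in> \<rat>" "algebraic_int (x + y * \<theta>\<^sup>2)"
  shows "algebraic_int (x - of_int a * y - y * \<theta>\<^sup>2)"
proof -
  have "algebraic_int ((x - y * of_int a / 2) + y / 2 * sqrt_delta)"
    using assms(3) by (simp add: sqrt_delta_def field_simps)
  then have "algebraic_int ((x - y * of_int a / 2) - y / 2 * sqrt_delta)"
    by (intro quad_conj_algebraic_int[OF number_subfield_Rats sqrt_delta_notin])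
       (use assms sqrt_delta_sq in auto)
  then show ?thesis by (simp add: sqrt_delta_def field_simps)
qed

text \<open>The trace \<open>t\<close> and norm \<open>n\<close> are rational integers with \<delta>
  y^2 = t^2 - 4 n. For odd \<open>a\<close>, squarefreeness of \<delta> makes \<open>y\<close> an
  integer. For even \<open>a\<close> the same argument applies to 2 y and \<delta> / 4, and a
  congruence modulo 4 shows that 2 y is even. Subtracting y \<phi> then leaves a rational algebraic
  integer \<open>x\<close>.\<close>

lemma base_integral_coords:
  assumes max: "quadratic_maximal a b" and xy: "x \<in> \<rat>" "y \<in> \<rat>" and int: "algebraic_int (x + y * \<theta>\<^sup>2)"
  shows "x \<in> \<int>" "y \<in> \<int>"
proof -
  note conj = base_conj_algebraic_int[OF xy int]
  define t where "t = 2 * x - of_int a * y"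
  define n where "n = x\<^sup>2 - of_int a * x * y + of_int b * y\<^sup>2"
  have "t = (x + y * \<theta>\<^sup>2) + (x - of_int a * y - y * \<theta>\<^sup>2)" by (simp add: t_def)
  then have "algebraic_int t" using algebraic_int_add_mult(1)[OF int conj] by simp
  moreover have "t \<in> \<rat>" using xy by (simp add: t_def)
  ultimately have "t \<in> \<int>" by (rule rational_algebraic_int_is_int)
  have "(x + y * \<theta>\<^sup>2) * (x - of_int a * y - y * \<theta>\<^sup>2) = x * x - of_int a * x * y - of_int a * y * y * \<theta>\<^sup>2 - y * y * (\<theta>\<^sup>2 * \<theta>\<^sup>2)"
    by (simp add: algebra_simps)
  also have "\<dots> = n" unfolding theta_sq_sq by (simp add: n_def algebra_simps power2_eq_square)
  finally have "algebraic_int n" using algebraic_int_add_mult(2)[OF int conj] by simp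
  moreover have "n \<in> \<rat>" using xy by (simp add: n_def)
  ultimately have "n \<in> \<int>" by (rule rational_algebraic_int_is_int)
  obtain t' n' where tn: "t = of_int t'" "n = of_int n'"
    using \<open>t \<in> \<int>\<close> \<open>n \<in> \<int>\<close> by (auto elim!: Ints_cases)
  have eq: "of_int (a\<^sup>2 - 4 * b) * y\<^sup>2 = t\<^sup>2 - 4 * n"
    by (simp add: t_def n_def power2_eq_square algebra_simps)
  show "y \<in> \<int>"
  proof (cases "even a")
    case False
    then have "squarefree (a\<^sup>2 - 4 * b)" using max by (simp add: quadratic_maximal_def)
    moreover have "of_int (a\<^sup>2 - 4 * b) * y\<^sup>2 \<in> \<int>" unfolding eq tn by simp
    ultimately show ?thesis using xy(2) squarefree_mult_square_in_Ints by blast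
  next
    case True
    define w where "w = (a div 2)\<^sup>2 - b"
    have a2: "a\<^sup>2 - 4 * b = 4 * w" using True by (auto simp: w_def power2_eq_square elim!: evenE)
    have w: "squarefree w" "w mod 4 \<in> {2, 3}" using max True by (auto simp: quadratic_maximal_def w_def)
    have eq': "of_int w * (2 * y)\<^sup>2 = t\<^sup>2 - 4 * n"
      using eq unfolding a2 by (simp add: power_mult_distrib algebra_simps)
    have "of_int w * (2 * y)\<^sup>2 \<in> \<int>" unfolding eq' tn by simp
    moreover have "2 * y \<in> \<rat>" using xy(2) by simp
    ultimately have "2 * y \<in> \<int>" using w(1) squarefree_mult_square_in_Ints by blast
    then obtain k where k: "2 * y = of_int k" by (auto elim!: Ints_cases)
    have "of_int (w * k\<^sup>2) = (of_int (t'\<^sup>2 - 4 * n') :: complex)"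
      using eq' by (simp add: k tn)
    then have "w * k\<^sup>2 = t'\<^sup>2 - 4 * n'" by (simp only: of_int_eq_iff)
    then have "even k" using dvd_4_if_odd[OF w(2), of t' k] by simp
    then obtain j where "k = 2 * j" ..
    then have "y = of_int j" using k by simp
    then show ?thesis by simp
  qed
  then obtain y' where y': "y = of_int y'" by (auto elim!: Ints_cases)
  have "algebraic_int (x + y * \<theta>\<^sup>2 - of_int y' * \<theta>\<^sup>2)"
    by (intro algebraic_int_diff int algebraic_int_add_mult(2)) auto
  then show "x \<in> \<int>" using xy by (intro rational_algebraic_int_is_int) (auto simp: y')
qed

lemma prime_divides_coords:
  fixes p c0 c1 c2 c3 :: int
  assumes max: "quadratic_maximal a b" and b: "squarefree b" and R: "(a mod 4, b mod 4) \<in> biquadratic_residues"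
    and p: "prime p"
    and int: "algebraic_int ((of_int c0 + of_int c1 * \<theta> + of_int c2 * \<theta>\<^sup>2 + of_int c3 * \<theta> ^ 3) / of_int p)"
  shows "p dvd c0 \<and> p dvd c1 \<and> p dvd c2 \<and> p dvd c3"
proof -
  have p0: "p \<noteq> 0" using p by auto
  define P where "P = (of_int p :: complex)"
  have P0: "P \<noteq> 0" using p0 by (simp add: P_def)
  have PQ: "P \<in> \<rat>" by (simp add: P_def)
  define A where "A = of_int c0 + of_int c2 * \<theta>\<^sup>2"
  define B where "B = of_int c1 + of_int c3 * \<theta>\<^sup>2"
  have AB: "A / P \<in> base_field" "B / P \<in> base_field"
    using base_fieldI[of "of_int c0 / P" "of_int c2 / P"] base_fieldI[of "of_int c1 / P" "of_int c3 / P"] PQ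
    by (auto simp: A_def B_def add_divide_distrib)
  have u: "algebraic_int (A / P + B / P * \<theta>)"
    using int by (simp add: A_def B_def P_def add_divide_distrib power2_eq_square power3_eq_cube algebra_simps)
  have u': "algebraic_int (A / P - B / P * \<theta>)"
    by (rule quad_conj_algebraic_int[OF number_subfield_base theta_notin theta_sq_in_base AB u])
  define n0 where "n0 = norm_coord0 a b c0 c1 c2 c3"
  define n1 where "n1 = norm_coord1 a b c0 c1 c2 c3"
  have norm_eq: "A * A - B * (B * \<theta>\<^sup>2) = of_int n0 + of_int n1 * \<theta>\<^sup>2"
  proof -
    define f where "f = \<theta>\<^sup>2"
    have ff: "f * f = - of_int a * f - of_int b" using theta_sq_sq by (simp add: f_def)
    have "f * (f * f) = f * (- of_int a * f - of_int b)" by (simp only: ff)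
    also have "\<dots> = - of_int a * (f * f) - of_int b * f" by (simp add: algebra_simps)
    finally have fff: "f * (f * f) = (of_int a * of_int a - of_int b) * f + of_int a * of_int b"
      unfolding ff by (simp add: algebra_simps)
    have "A * A - B * (B * f) = of_int c0 * of_int c0 + 2 * of_int c0 * of_int c2 * f + of_int c2 * of_int c2 * (f * f)
      - of_int c1 * of_int c1 * f - 2 * of_int c1 * of_int c3 * (f * f) - of_int c3 * of_int c3 * (f * (f * f))"
      unfolding A_def B_def f_def[symmetric] by Groebner_Basis.algebra
    also have "\<dots> = of_int n0 + of_int n1 * f"
      unfolding fff unfolding ff n0_def n1_def norm_coord0_def norm_coord1_def of_int_add of_int_diff of_int_mult
        of_int_power of_int_numeral by Groebner_Basis.algebra
    finally show ?thesis by (simp add: f_def)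
  qed
  have trace: "algebraic_int (of_int (2 * c0) / P + of_int (2 * c2) / P * \<theta>\<^sup>2)"
  proof -
    have "of_int (2 * c0) / P + of_int (2 * c2) / P * \<theta>\<^sup>2 = (A / P + B / P * \<theta>) + (A / P - B / P * \<theta>)"
      by (simp add: A_def add_divide_distrib algebra_simps)
    then show ?thesis using algebraic_int_add_mult(1)[OF u u'] by simp
  qed
  have "of_int (2 * c0) / P \<in> \<int>" "of_int (2 * c2) / P \<in> \<int>"
    using base_integral_coords[OF max _ _ trace] PQ by auto
  then have d2: "p dvd 2 * c0" "p dvd 2 * c2"
    using of_int_divide_in_Ints_dvd p0 unfolding P_def by blast+
  have norm_alg: "algebraic_int ((A * A - B * (B * \<theta>\<^sup>2)) / P\<^sup>2)"
  proof -
    have "(A * A - B * (B * \<theta>\<^sup>2)) / P\<^sup>2 = (A / P + B / P * \<theta>) * (A / P - B / P * \<theta>)"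
      using P0 by (simp add: field_simps power2_eq_square)
    then show ?thesis using algebraic_int_add_mult(2)[OF u u'] by simp
  qed
  then have norm: "algebraic_int (of_int n0 / P\<^sup>2 + of_int n1 / P\<^sup>2 * \<theta>\<^sup>2)"
    unfolding norm_eq by (simp add: add_divide_distrib)
  have "of_int n0 / of_int (p\<^sup>2) \<in> (\<int> :: complex set)" "of_int n1 / of_int (p\<^sup>2) \<in> (\<int> :: complex set)"
    using base_integral_coords[OF max _ _ norm] PQ by (auto simp: P_def)
  then have n: "p\<^sup>2 dvd n0" "p\<^sup>2 dvd n1"
    using of_int_divide_in_Ints_dvd p0 by (metis power_not_zero)+
  have c02: "p dvd c0" "p dvd c2"
  proof -
    have "p dvd c0 \<and> p dvd c2"
    proof (cases "p = 2")
      case True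
      \<comment> \<open>For \<open>p = 2\<close> the trace condition \<open>d2\<close> is vacuous,
        so the norm modulo 4 has to do the work.\<close>
      then show ?thesis using even_of_norm_coords[OF R] n by (simp add: n0_def n1_def)
    next
      case False
      have "\<not> p dvd 2"
        using False p primes_dvd_imp_eq[of p 2] by auto
      then show ?thesis using d2 p by (simp add: prime_dvd_mult_iff)
    qed
    then show "p dvd c0" "p dvd c2" by auto
  qed
  then obtain k0 k2 where k: "c0 = p * k0" "c2 = p * k2" by (auto elim!: dvdE)
  have AP: "A / P = of_int k0 + of_int k2 * \<theta>\<^sup>2"
    unfolding A_def k of_int_mult P_def[symmetric] using P0 by (simp add: add_divide_distrib)
  then have "algebraic_int (A / P)" by (auto intro!: algebraic_int_add_mult)
  then have "algebraic_int ((A / P) * (A / P) - (A * A - B * (B * \<theta>\<^sup>2)) / P\<^sup>2)"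
    by (intro algebraic_int_diff algebraic_int_add_mult(2) norm_alg)
  also have "(A / P) * (A / P) - (A * A - B * (B * \<theta>\<^sup>2)) / P\<^sup>2 = B * (B * \<theta>\<^sup>2) / P\<^sup>2"
    by (simp add: diff_divide_distrib power2_eq_square[of P])
  \<comment> \<open>The extra factor \<phi> makes this the square of an element of
    \<open>base_field\<close>, to which \<open>base_integral_coords\<close> applies.\<close>
  finally have "algebraic_int (\<theta>\<^sup>2 * (B * (B * \<theta>\<^sup>2) / P\<^sup>2))"
    by (rule algebraic_int_add_mult(2)[OF algebraic_int_theta_sq])
  also have "\<theta>\<^sup>2 * (B * (B * \<theta>\<^sup>2) / P\<^sup>2) = (\<theta>\<^sup>2 * B / P)\<^sup>2"
    by (simp add: power2_eq_square)
  finally have "algebraic_int (\<theta>\<^sup>2 * B / P)" by (rule algebraic_int_sqrtD)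
  also have "\<theta>\<^sup>2 * B / P = of_int (- (b * c3)) / P + of_int (c1 - a * c3) / P * \<theta>\<^sup>2"
  proof -
    have "\<theta>\<^sup>2 * B = of_int (- (b * c3)) + of_int (c1 - a * c3) * \<theta>\<^sup>2"
    proof -
      have "\<theta>\<^sup>2 * B = of_int c1 * \<theta>\<^sup>2 + of_int c3 * (\<theta>\<^sup>2 * \<theta>\<^sup>2)"
        by (simp add: B_def algebra_simps)
      then show ?thesis unfolding theta_sq_sq by (simp add: algebra_simps)
    qed
    then show ?thesis by (simp add: add_divide_distrib diff_divide_distrib left_diff_distrib)
  qed
  finally have "of_int (- (b * c3)) / P \<in> \<int>" "of_int (c1 - a * c3) / P \<in> \<int>"
    using base_integral_coords[OF max, of "of_int (- (b * c3)) / P" "of_int (c1 - a * c3) / P"] PQ by auto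
  then have "p dvd - (b * c3)" "p dvd c1 - a * c3"
    using of_int_divide_in_Ints_dvd p0 unfolding P_def by blast+
  then have "p dvd c1 \<and> p dvd c3"
    using dvd_of_norm_coords[OF p b c02, of a c1 c3] n by (simp add: n0_def n1_def)
  then show ?thesis using c02 by simp
qed

text \<open>Write n = p m. Multiplying by \<open>m\<close> leaves the denominator \<open>p\<close>
  and the prime case; after cancelling \<open>p\<close> from the coordinates the denominator is
  \<open>m\<close>, which is the induction step.\<close>

lemma denominator_divides_coords:
  fixes n :: nat and c0 c1 c2 c3 :: int
  assumes max: "quadratic_maximal a b" and b: "squarefree b" and R: "(a mod 4, b mod 4) \<in> biquadratic_residues"
    and "n > 0"
    and "algebraic_int ((of_int c0 + of_int c1 * \<theta> + of_int c2 * \<theta>\<^sup>2 + of_int c3 * \<theta> ^ 3) / of_nat n)"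
  shows "int n dvd c0 \<and> int n dvd c1 \<and> int n dvd c2 \<and> int n dvd c3"
  using assms(4,5)
proof (induction n arbitrary: c0 c1 c2 c3 rule: less_induct)
  case (less n)
  show ?case
  proof (cases "n = 1")
    case False
    then obtain p where p: "prime p" "p dvd n" using prime_factor_nat by blast
    then obtain m where m: "n = p * m" by (auto elim: dvdE)
    have pm: "p > 1" "m > 0" "m < n" using p(1) m less.prems(1) prime_gt_1_nat by auto
    let ?u = "of_int c0 + of_int c1 * \<theta> + of_int c2 * \<theta>\<^sup>2 + of_int c3 * \<theta> ^ 3"
    have "algebraic_int (of_int (int m) * (?u / of_nat n))"
      by (intro algebraic_int_add_mult(2) less.prems(2)) simp
    also have "of_int (int m) * (?u / of_nat n) = ?u / of_int (int p)"
      using pm by (simp add: m)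
    finally have "int p dvd c0 \<and> int p dvd c1 \<and> int p dvd c2 \<and> int p dvd c3"
      using p(1) by (intro prime_divides_coords[OF max b R]) auto
    then obtain d0 d1 d2 d3 where d: "c0 = int p * d0" "c1 = int p * d1" "c2 = int p * d2" "c3 = int p * d3"
      by (auto elim!: dvdE)
    have "?u / of_nat n = (of_int d0 + of_int d1 * \<theta> + of_int d2 * \<theta>\<^sup>2 + of_int d3 * \<theta> ^ 3) / of_nat m"
      using pm by (simp add: d m field_simps)
    then have "int m dvd d0 \<and> int m dvd d1 \<and> int m dvd d2 \<and> int m dvd d3"
      using less.prems(2) pm by (intro less.IH) auto
    then show ?thesis by (simp add: d m mult_dvd_mono)
  qed auto
qed

text \<open>The one nontrivial inclusion, of the ring of integers in Z[\<theta>], expressed in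
  coordinates.\<close>

definition power_basis_integral :: bool where
  "power_basis_integral \<longleftrightarrow> (\<forall>c0\<in>\<rat>. \<forall>c1\<in>\<rat>. \<forall>c2\<in>\<rat>. \<forall>c3\<in>\<rat>.
     algebraic_int (c0 + c1 * \<theta> + c2 * \<theta>\<^sup>2 + c3 * \<theta> ^ 3) \<longrightarrow>
       c0 \<in> \<int> \<and> c1 \<in> \<int> \<and> c2 \<in> \<int> \<and> c3 \<in> \<int>)"

lemma power_basis_integral_if:
  assumes max: "quadratic_maximal a b" and b: "squarefree b" and R: "(a mod 4, b mod 4) \<in> biquadratic_residues"
  shows power_basis_integral
  unfolding power_basis_integral_def
proof (intro ballI impI)
  fix c0 c1 c2 c3 :: complex
  assume rat: "c0 \<in> \<rat>" "c1 \<in> \<rat>" "c2 \<in> \<rat>" "c3 \<in> \<rat>"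
    and int: "algebraic_int (c0 + c1 * \<theta> + c2 * \<theta>\<^sup>2 + c3 * \<theta> ^ 3)"
  have den: "\<exists>k n. n > 0 \<and> c = of_int k / of_nat n" if "c \<in> \<rat>" for c :: complex
  proof -
    obtain p q where "q > 0" "c = of_int p / of_int q" using \<open>c \<in> \<rat>\<close> by (elim Rats_cases')
    then show ?thesis by (intro exI[of _ p] exI[of _ "nat q"]) auto
  qed
  obtain k0 n0 k1 n1 k2 n2 k3 n3 where *: "n0 > 0" "n1 > 0" "n2 > 0" "n3 > 0"
    "c0 = of_int k0 / of_nat n0" "c1 = of_int k1 / of_nat n1" "c2 = of_int k2 / of_nat n2" "c3 = of_int k3 / of_nat n3"
    using den[OF rat(1)] den[OF rat(2)] den[OF rat(3)] den[OF rat(4)] by blast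
  define n where "n = n0 * n1 * n2 * n3"
  define d0 where "d0 = k0 * int (n1 * n2 * n3)"
  define d1 where "d1 = k1 * int (n0 * n2 * n3)"
  define d2 where "d2 = k2 * int (n0 * n1 * n3)"
  define d3 where "d3 = k3 * int (n0 * n1 * n2)"
  have n: "n > 0" using * by (simp add: n_def)
  have c: "c0 = of_int d0 / of_nat n" "c1 = of_int d1 / of_nat n" "c2 = of_int d2 / of_nat n" "c3 = of_int d3 / of_nat n"
    using * by (simp_all add: n_def d0_def d1_def d2_def d3_def field_simps)
  have "algebraic_int ((of_int d0 + of_int d1 * \<theta> + of_int d2 * \<theta>\<^sup>2 + of_int d3 * \<theta> ^ 3) / of_nat n)"
    using int unfolding c by (simp add: add_divide_distrib)
  from denominator_divides_coords[OF max b R n this]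
  have d: "int n dvd d0" "int n dvd d1" "int n dvd d2" "int n dvd d3" by auto
  have "of_int d / of_nat n \<in> (\<int> :: complex set)" if "int n dvd d" for d
    using that n by (auto elim!: dvdE)
  then show "c0 \<in> \<int> \<and> c1 \<in> \<int> \<and> c2 \<in> \<int> \<and> c3 \<in> \<int>"
    using d unfolding c by blast
qed

end

section \<open>Characterisation of monogenicity\<close>

text \<open>The quantity called \<open>W\<close> in the theorem.\<close>

definition reduced_discriminant :: "int \<Rightarrow> int \<Rightarrow> int" where
  "reduced_discriminant a b = (a\<^sup>2 - 4 * b) div (gcd 2 a)\<^sup>2"

lemma reduced_discriminant_even: "even a \<Longrightarrow> reduced_discriminant a b = (a div 2)\<^sup>2 - b"
  by (auto simp: reduced_discriminant_def gcd_proj1_iff power2_eq_square elim!: evenE)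

lemma reduced_discriminant_odd: "odd a \<Longrightarrow> reduced_discriminant a b = a\<^sup>2 - 4 * b"
proof -
  assume "odd a"
  then have "coprime 2 a" by simp
  then show ?thesis by (simp add: reduced_discriminant_def)
qed

lemma reduced_discriminant_mod_4:
  assumes "even a"
  shows "reduced_discriminant a b mod 4 = (if 4 dvd a then - b else 1 - b) mod 4"
proof -
  have "((a div 2)\<^sup>2 - b) mod 4 = ((a div 2)\<^sup>2 mod 4 - b) mod 4" by (simp add: mod_simps)
  moreover have "even (a div 2) \<longleftrightarrow> 4 dvd a" using assms by presburger
  ultimately show ?thesis using assms by (simp add: reduced_discriminant_even int_square_mod_4)
qed

lemma squarefree_not_4_dvd: "squarefree (n :: int) \<Longrightarrow> n mod 4 \<noteq> 0"
proof
  assume *: "squarefree n" "n mod 4 = 0"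
  then have "(2 :: int)\<^sup>2 dvd n" by (simp add: mod_0_imp_dvd)
  with *(1) have "(2 :: int) dvd 1" unfolding squarefree_def by blast
  then show False by simp
qed

text \<open>For even \<open>a\<close> the reduced discriminant is congruent to -b if 4 divides
  \<open>a\<close> and to 1 - b otherwise; the admissible pairs with even \<open>a\<close> are
  exactly those for which this is 2 or 3 modulo 4.\<close>

lemma quadratic_maximal_if:
  assumes "squarefree (reduced_discriminant a b)" "(a mod 4, b mod 4) \<in> biquadratic_residues"
  shows "quadratic_maximal a b"
proof (cases "even a")
  case False
  then show ?thesis using assms by (simp add: quadratic_maximal_def reduced_discriminant_odd)
next
  case True
  have "reduced_discriminant a b mod 4 \<in> {2, 3}"
  proof (cases "4 dvd a")
    case True
    then have "a mod 4 = 0" by presburger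
    then have "b mod 4 \<in> {1, 2}" using assms(2) by (auto simp: biquadratic_residues_def)
    then have "b mod 4 = 1 \<or> b mod 4 = 2" by simp
    then have "(- b) mod 4 = 2 \<or> (- b) mod 4 = 3" by presburger
    then show ?thesis using reduced_discriminant_mod_4[OF \<open>even a\<close>, of b] True by simp
  next
    case False
    with \<open>even a\<close> have "a mod 4 = 2" by presburger
    then have "b mod 4 \<in> {2, 3}" using assms(2) by (auto simp: biquadratic_residues_def)
    then have "b mod 4 = 2 \<or> b mod 4 = 3" by simp
    then have "(1 - b) mod 4 = 2 \<or> (1 - b) mod 4 = 3" by presburger
    then show ?thesis using reduced_discriminant_mod_4[OF \<open>even a\<close>, of b] False by simp
  qed
  then show ?thesis
    using True assms(1) by (simp add: quadratic_maximal_def reduced_discriminant_even)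
qed

context irreducible_biquadratic
begin

lemma power_coords_unique:
  assumes "c0 \<in> \<rat>" "c1 \<in> \<rat>" "c2 \<in> \<rat>" "c3 \<in> \<rat>" "d0 \<in> \<rat>" "d1 \<in> \<rat>" "d2 \<in> \<rat>" "d3 \<in> \<rat>"
    and "c0 + c1 * \<theta> + c2 * \<theta>\<^sup>2 + c3 * \<theta> ^ 3 = d0 + d1 * \<theta> + d2 * \<theta>\<^sup>2 + d3 * \<theta> ^ 3"
  shows "c0 = d0 \<and> c1 = d1 \<and> c2 = d2 \<and> c3 = d3"
  using powers_independent[of "c0 - d0" "c1 - d1" "c2 - d2" "c3 - d3"] assms
  by (simp add: algebra_simps)

lemma powers_distinct:
  "1 \<noteq> \<theta>" "1 \<noteq> \<theta>\<^sup>2" "1 \<noteq> \<theta> ^ 3" "\<theta> \<noteq> \<theta>\<^sup>2" "\<theta> \<noteq> \<theta> ^ 3" "\<theta>\<^sup>2 \<noteq> \<theta> ^ 3"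
  using power_coords_unique[of 1 0 0 0 0 1 0 0] power_coords_unique[of 1 0 0 0 0 0 1 0]
    power_coords_unique[of 1 0 0 0 0 0 0 1] power_coords_unique[of 0 1 0 0 0 0 1 0]
    power_coords_unique[of 0 1 0 0 0 0 0 1] power_coords_unique[of 0 0 1 0 0 0 0 1] by auto

lemma power_basis_set: "{\<theta> ^ i | i. i < 4} = {1, \<theta>, \<theta>\<^sup>2, \<theta> ^ 3}"
proof -
  have "{\<theta> ^ i | i. i < 4} = (^) \<theta> ` {..<4}" by auto
  also have "{..<4::nat} = {0, 1, 2, 3}" by auto
  finally show ?thesis by simp
qed

lemma power_basis_sum:
  "(\<Sum>v\<in>{1, \<theta>, \<theta>\<^sup>2, \<theta> ^ 3}. of_int (u v) * v) =
     of_int (u 1) + of_int (u \<theta>) * \<theta> + of_int (u (\<theta>\<^sup>2)) * \<theta>\<^sup>2 + of_int (u (\<theta> ^ 3)) * \<theta> ^ 3"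
  using powers_distinct by (simp add: add.assoc)

text \<open>The powers of \<theta> are always independent, and their span always consists of
  integers of the field; only the reverse inclusion is in question.\<close>

lemma is_int_basis_iff:
  "is_int_basis {\<theta> ^ i | i. i < 4} (ring_of_integers (rat_adjoin {\<theta>})) \<longleftrightarrow> power_basis_integral"
proof -
  let ?P = "{1, \<theta>, \<theta>\<^sup>2, \<theta> ^ 3}"
  have span: "int_span ?P = range (\<lambda>u. of_int (u 1) + of_int (u \<theta>) * \<theta> + of_int (u (\<theta>\<^sup>2)) * \<theta>\<^sup>2 + of_int (u (\<theta> ^ 3)) * \<theta> ^ 3)"
    unfolding power_basis_sum[symmetric] by (rule int_span_finite) simp
  have indep: "\<not> Modules.module.dependent int_scale ?P"
  proof
    assume "Modules.module.dependent int_scale ?P"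
    then obtain u where u: "\<exists>v\<in>?P. u v \<noteq> 0" "(\<Sum>v\<in>?P. of_int (u v) * v) = 0"
      using Modules.module.dependent_finite[OF int_module, of ?P] by auto
    from u(2) have "u 1 = 0 \<and> u \<theta> = 0 \<and> u (\<theta>\<^sup>2) = 0 \<and> u (\<theta> ^ 3) = 0"
      unfolding power_basis_sum by (auto dest!: powers_independent[rotated 4])
    with u(1) show False by blast
  qed
  have sub: "int_span ?P \<subseteq> ring_of_integers (rat_adjoin {\<theta>})"
  proof
    fix z assume "z \<in> int_span ?P"
    then obtain u where z: "z = of_int (u 1) + of_int (u \<theta>) * \<theta> + of_int (u (\<theta>\<^sup>2)) * \<theta>\<^sup>2 + of_int (u (\<theta> ^ 3)) * \<theta> ^ 3"
      unfolding span by blast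
    have "algebraic_int (\<theta> * \<theta>\<^sup>2)" by (intro algebraic_int_add_mult(2)) auto
    then have "algebraic_int (\<theta> ^ 3)" by (simp add: power2_eq_square power3_eq_cube mult.assoc)
    then have "algebraic_int z" unfolding z by (intro algebraic_int_add_mult) auto
    moreover have "z \<in> rat_adjoin {\<theta>}" unfolding z by (intro rat_adjoin_thetaI) auto
    ultimately show "z \<in> ring_of_integers (rat_adjoin {\<theta>})" by (simp add: ring_of_integers_def)
  qed
  have "ring_of_integers (rat_adjoin {\<theta>}) \<subseteq> int_span ?P \<longleftrightarrow> power_basis_integral"
  proof
    assume pb: power_basis_integral
    show "ring_of_integers (rat_adjoin {\<theta>}) \<subseteq> int_span ?P"
    proof
      fix z assume "z \<in> ring_of_integers (rat_adjoin {\<theta>})"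
      then have z: "z \<in> rat_adjoin {\<theta>}" "algebraic_int z" by (auto simp: ring_of_integers_def)
      obtain c0 c1 c2 c3 where c: "c0 \<in> \<rat>" "c1 \<in> \<rat>" "c2 \<in> \<rat>" "c3 \<in> \<rat>"
        "z = c0 + c1 * \<theta> + c2 * \<theta>\<^sup>2 + c3 * \<theta> ^ 3" by (rule rat_adjoin_thetaE[OF z(1)])
      then have "c0 \<in> \<int> \<and> c1 \<in> \<int> \<and> c2 \<in> \<int> \<and> c3 \<in> \<int>"
        using pb z(2) unfolding power_basis_integral_def by blast
      then obtain k0 k1 k2 k3 where k: "c0 = of_int k0" "c1 = of_int k1" "c2 = of_int k2" "c3 = of_int k3"
        by (auto elim!: Ints_cases)
      define u where "u = (\<lambda>v. if v = 1 then k0 else if v = \<theta> then k1 else if v = \<theta>\<^sup>2 then k2 else k3)"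
      have u: "u 1 = k0" "u \<theta> = k1" "u (\<theta>\<^sup>2) = k2" "u (\<theta> ^ 3) = k3"
        using powers_distinct by (auto simp: u_def)
      show "z \<in> int_span ?P"
        unfolding span by (rule range_eqI[of _ _ u]) (simp only: u c(5) k)
    qed
  next
    assume *: "ring_of_integers (rat_adjoin {\<theta>}) \<subseteq> int_span ?P"
    show power_basis_integral
      unfolding power_basis_integral_def
    proof (intro ballI impI)
      fix c0 c1 c2 c3 :: complex
      assume c: "c0 \<in> \<rat>" "c1 \<in> \<rat>" "c2 \<in> \<rat>" "c3 \<in> \<rat>"
        and int: "algebraic_int (c0 + c1 * \<theta> + c2 * \<theta>\<^sup>2 + c3 * \<theta> ^ 3)"
      have "c0 + c1 * \<theta> + c2 * \<theta>\<^sup>2 + c3 * \<theta> ^ 3 \<in> int_span ?P"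
        using * int rat_adjoin_thetaI[OF c] by (auto simp: ring_of_integers_def)
      then obtain u where "c0 + c1 * \<theta> + c2 * \<theta>\<^sup>2 + c3 * \<theta> ^ 3 =
          of_int (u 1) + of_int (u \<theta>) * \<theta> + of_int (u (\<theta>\<^sup>2)) * \<theta>\<^sup>2 + of_int (u (\<theta> ^ 3)) * \<theta> ^ 3"
        unfolding span by blast
      from power_coords_unique[OF c _ _ _ _ this]
      show "c0 \<in> \<int> \<and> c1 \<in> \<int> \<and> c2 \<in> \<int> \<and> c3 \<in> \<int>" by auto
    qed
  qed
  then show ?thesis
    using indep sub unfolding is_int_basis_def power_basis_set by auto
qed

section \<open>Integral elements with denominators when a condition fails\<close>

lemma algebraic_int_quadratic_over_base:
  assumes u: "u\<^sup>2 = (of_int s0 + of_int s1 * \<theta>\<^sup>2) * u + (of_int t0 + of_int t1 * \<theta>\<^sup>2)"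
  shows "algebraic_int u"
proof -
  \<comment> \<open>the product of the quadratic polynomial of \<open>u\<close> and its conjugate\<close>
  define p where "p = [:t0 * t0 - a * (t0 * t1) + b * (t1 * t1),
    2 * (s0 * t0) - a * (s0 * t1 + s1 * t0) + 2 * b * (s1 * t1),
    s0 * s0 - a * (s0 * s1) + b * (s1 * s1) - (2 * t0 - a * t1), - (2 * s0 - a * s1), 1:]"
  have "poly (map_poly of_int p) u = 0"
  proof -
    define A B S0 S1 T0 T1 f where *: "A = (of_int a :: complex)" "B = (of_int b :: complex)"
      "S0 = (of_int s0 :: complex)" "S1 = (of_int s1 :: complex)" "T0 = (of_int t0 :: complex)" "T1 = (of_int t1 :: complex)"
      "f = \<theta>\<^sup>2"
    have ff: "f * f = - A * f - B" using theta_sq_sq by (simp add: *)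
    have "poly (map_poly of_int p) u = T0 * T0 - A * (T0 * T1) + B * (T1 * T1)
      + u * (2 * (S0 * T0) - A * (S0 * T1 + S1 * T0) + 2 * B * (S1 * T1)
      + u * (S0 * S0 - A * (S0 * S1) + B * (S1 * S1) - (2 * T0 - A * T1) + u * (- (2 * S0 - A * S1) + u * 1)))"
      unfolding p_def by (simp add: map_poly_pCons *)
    also have "\<dots> = (u * u - (S0 + S1 * f) * u - (T0 + T1 * f)) * (u * u - (S0 - A * S1 - S1 * f) * u - (T0 - A * T1 - T1 * f))"
      using ff by Groebner_Basis.algebra
    also have "u * u - (S0 + S1 * f) * u - (T0 + T1 * f) = 0"
      using u unfolding *[symmetric] by (simp add: power2_eq_square)
    finally show ?thesis by simp
  qed
  then show ?thesis unfolding algebraic_int_altdef_ipoly by (intro exI[of _ p]) (simp add: p_def)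
qed

lemma squarefree_b_if_integral:
  assumes pb: power_basis_integral and "b \<noteq> 0"
  shows "squarefree b"
  unfolding squarefree_def
proof (intro allI impI)
  fix x assume "x\<^sup>2 dvd b"
  then obtain m where m: "b = x\<^sup>2 * m" ..
  with \<open>b \<noteq> 0\<close> have x: "x \<noteq> 0" by auto
  \<comment> \<open>The numerator is \<theta> (\<phi> + a) = -b / \<theta>. Modulo a prime factor of
    \<open>b\<close> the quartic is X^2 (X^2 + a), and dropping one factor X gives this
    numerator.\<close>
  define u where "u = (of_int a * \<theta> + \<theta> ^ 3) / of_int x"
  have "(of_int a * \<theta> + \<theta> ^ 3)\<^sup>2 = - of_int b * (\<theta>\<^sup>2 + of_int a)"
  proof -
    have "(of_int a * \<theta> + \<theta> ^ 3)\<^sup>2 = (\<theta>\<^sup>2 * \<theta>\<^sup>2 + of_int a * \<theta>\<^sup>2) * (\<theta>\<^sup>2 + of_int a)"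
      by (simp add: power2_eq_square power3_eq_cube algebra_simps)
    then show ?thesis unfolding theta_sq_sq by simp
  qed
  then have "u\<^sup>2 = of_int (- m) * (\<theta>\<^sup>2 + of_int a)"
    using x by (simp add: u_def power_divide m)
  moreover have "algebraic_int \<dots>" by (intro algebraic_int_add_mult) auto
  ultimately have "algebraic_int u" using algebraic_int_sqrtD by metis
  then have "algebraic_int (0 + of_int a / of_int x * \<theta> + 0 * \<theta>\<^sup>2 + 1 / of_int x * \<theta> ^ 3)"
    by (simp add: u_def add_divide_distrib)
  then have "(1 / of_int x :: complex) \<in> \<int>"
    using pb unfolding power_basis_integral_def by (metis Rats_0 Rats_1 Rats_divide Rats_of_int)
  then show "x dvd 1" using of_int_divide_in_Ints_dvd[of 1 x] x by simp
qed

text \<open>If \<open>x\<^sup>2\<close> divides the reduced discriminant, a square root of the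
  latter divided by \<open>x\<close> is still integral. For even \<open>a\<close> that root is a / 2
  + \<phi>, with \<phi>-coordinate 1. For odd \<open>a\<close> it is \<open>sqrt_delta\<close>, with
  coordinates a and 2, so \<open>x\<close> divides two coprime numbers.\<close>

lemma squarefree_discriminant_if_integral:
  assumes pb: power_basis_integral
  shows "squarefree (reduced_discriminant a b)"
  unfolding squarefree_def
proof (intro allI impI)
  fix x assume "x\<^sup>2 dvd reduced_discriminant a b"
  then obtain m where m: "reduced_discriminant a b = x\<^sup>2 * m" ..
  have "sqrt_delta \<noteq> 0" using sqrt_delta_notin by auto
  then have nz: "a\<^sup>2 - 4 * b \<noteq> 0" using sqrt_delta_sq by (metis of_int_0 power_not_zero)
  show "x dvd 1"
  proof (cases "even a")
    case True
    then obtain e where e: "a = 2 * e" ..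
    have m': "e\<^sup>2 - b = x\<^sup>2 * m" using m True e by (simp add: reduced_discriminant_even)
    have x: "x \<noteq> 0" using nz m' by (auto simp: e power_mult_distrib)
    define u where "u = (of_int e + \<theta>\<^sup>2) / of_int x"
    have "(of_int e + \<theta>\<^sup>2)\<^sup>2 = of_int e * of_int e + 2 * of_int e * \<theta>\<^sup>2 + \<theta>\<^sup>2 * \<theta>\<^sup>2"
      by (simp add: power2_eq_square algebra_simps)
    also have "\<dots> = of_int (e\<^sup>2 - b)" unfolding theta_sq_sq by (simp add: e power2_eq_square)
    finally have "u\<^sup>2 = of_int m" using x by (simp add: u_def power_divide m')
    then have "algebraic_int u" using algebraic_int_sqrtD by (metis algebraic_int_of_int)
    then have "algebraic_int (of_int e / of_int x + 0 * \<theta> + 1 / of_int x * \<theta>\<^sup>2 + 0 * \<theta> ^ 3)"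
      by (simp add: u_def add_divide_distrib)
    then have "(1 / of_int x :: complex) \<in> \<int>"
      using pb unfolding power_basis_integral_def by (metis Rats_0 Rats_1 Rats_divide Rats_of_int)
    then show ?thesis using of_int_divide_in_Ints_dvd[of 1 x] x by simp
  next
    case False
    then have m': "a\<^sup>2 - 4 * b = x\<^sup>2 * m" using m by (simp add: reduced_discriminant_odd)
    have x: "x \<noteq> 0" using nz m' by auto
    have "(sqrt_delta / of_int x)\<^sup>2 = of_int m" using x by (simp only: power_divide sqrt_delta_sq m') simp
    then have "algebraic_int (sqrt_delta / of_int x)" using algebraic_int_sqrtD by (metis algebraic_int_of_int)
    then have "algebraic_int (of_int a / of_int x + 0 * \<theta> + of_int 2 / of_int x * \<theta>\<^sup>2 + 0 * \<theta> ^ 3)"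
      by (simp add: sqrt_delta_def add_divide_distrib add.commute)
    then have "(of_int a / of_int x :: complex) \<in> \<int>" "(of_int 2 / of_int x :: complex) \<in> \<int>"
      using pb unfolding power_basis_integral_def by (metis Rats_0 Rats_divide Rats_of_int)+
    then have "x dvd a" "x dvd 2" using of_int_divide_in_Ints_dvd x by blast+
    moreover have "coprime a 2" using False by simp
    ultimately show ?thesis using coprime_common_divisor by blast
  qed
qed

text \<open>Each exceptional element constructed below has coordinate 1/2 at \<phi>, so this is the
  common way to a contradiction.\<close>

lemma half_coord_contra:
  assumes pb: power_basis_integral and "c0 \<in> \<rat>" "c1 \<in> \<rat>" "c3 \<in> \<rat>"
    and "algebraic_int (c0 + c1 * \<theta> + 1 / 2 * \<theta>\<^sup>2 + c3 * \<theta> ^ 3)"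
  shows False
proof -
  have "(1 / 2 :: complex) \<in> \<rat>" by simp
  then have "(1 / 2 :: complex) \<in> \<int>"
    using assms unfolding power_basis_integral_def by blast
  then show False using of_int_divide_in_Ints_dvd[of 1 2] by simp
qed

lemma residues_if_integral:
  assumes pb: power_basis_integral and "b \<noteq> 0"
  shows "(a mod 4, b mod 4) \<in> biquadratic_residues"
proof -
  define f where "f = \<theta>\<^sup>2"
  have ff: "f * f = - of_int a * f - of_int b" using theta_sq_sq by (simp add: f_def)
  have b0: "b mod 4 \<noteq> 0"
    using squarefree_b_if_integral[OF assms] by (rule squarefree_not_4_dvd)
  have W0: "reduced_discriminant a b mod 4 \<noteq> 0"
    using squarefree_discriminant_if_integral[OF pb] by (rule squarefree_not_4_dvd)
  have n21: "\<not> (a mod 4 = 2 \<and> b mod 4 = 1)"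
  proof
    assume *: "a mod 4 = 2 \<and> b mod 4 = 1"
    then have "even a" "\<not> 4 dvd a" "(1 - b) mod 4 = 0" by presburger+
    then show False using reduced_discriminant_mod_4[of a b] W0 by simp
  qed
  have n03: "\<not> (a mod 4 = 0 \<and> b mod 4 = 3)"
  proof
    assume *: "a mod 4 = 0 \<and> b mod 4 = 3"
    then have "4 dvd a" by presburger
    then obtain i where i: "a = 4 * i" ..
    have "4 dvd 4 * i\<^sup>2 - b - 1" using * by presburger
    then obtain k where k: "4 * i\<^sup>2 - b - 1 = 4 * k" ..
    then have b: "b = 4 * i\<^sup>2 - 4 * k - 1" by simp
    \<comment> \<open>Here 2 i + \<phi> is a square root of the reduced discriminant D, which is 1
      modulo 4, so this is the familiar (1 + sqrt D) / 2, a root of X^2 - X - k.\<close>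
    define u where "u = (1 + 2 * of_int i + f) / 2"
    have "u\<^sup>2 - u = ((2 * of_int i + f) * (2 * of_int i + f) - 1) / 4"
      by (simp add: u_def power2_eq_square field_simps)
    also have "(2 * of_int i + f) * (2 * of_int i + f) - 1 = 4 * of_int i * of_int i + 4 * of_int i * f + f * f - 1"
      by (simp add: algebra_simps)
    also have "\<dots> = 4 * of_int k" unfolding ff by (simp add: i b algebra_simps power2_eq_square)
    finally have "u\<^sup>2 = (of_int 1 + of_int 0 * \<theta>\<^sup>2) * u + (of_int k + of_int 0 * \<theta>\<^sup>2)"
      by (simp add: algebra_simps)
    then have "algebraic_int u" by (rule algebraic_int_quadratic_over_base)
    then have "algebraic_int ((1 + 2 * of_int i) / 2 + 0 * \<theta> + 1 / 2 * \<theta>\<^sup>2 + 0 * \<theta> ^ 3)"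
      by (simp add: u_def f_def add_divide_distrib)
    from half_coord_contra[OF pb _ _ _ this] show False by auto
  qed
  have n12: "\<not> (a mod 4 = 1 \<and> b mod 4 = 2)"
  proof
    assume *: "a mod 4 = 1 \<and> b mod 4 = 2"
    obtain i j where ij: "a = 4 * i + 1" "b = 4 * j + 2"
      using * by (metis mult_div_mod_eq)
    \<comment> \<open>Modulo 2 the quartic is X^2 (X + 1)^2, and Dedekind's criterion fails at X +
      1; dropping one such factor leaves X^2 (X + 1).\<close>
    define u where "u = f * (1 + \<theta>) / 2"
    define s where "s = 4 * i * i + 3 * i - j"
    define t where "t = (2 * j + 1) * (2 * i + 1)"
    have "f * (f * f) = f * (- of_int a * f - of_int b)" by (simp only: ff)
    also have "\<dots> = - of_int a * (f * f) - of_int b * f" by (simp add: algebra_simps)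
    finally have fff: "f * (f * f) = (of_int a * of_int a - of_int b) * f + of_int a * of_int b"
      unfolding ff by (simp add: algebra_simps)
    have "u\<^sup>2 - f * u = (f * (f * \<theta>\<^sup>2) - f * f) / 4"
      by (simp add: u_def power2_eq_square field_simps)
    also have "\<dots> = (f * (f * f) - f * f) / 4" by (simp add: f_def)
    also have "f * (f * f) - f * f = 4 * (of_int t + of_int s * f)"
      unfolding fff unfolding ff s_def t_def ij by (simp add: algebra_simps)
    finally have "u\<^sup>2 = (of_int 0 + of_int 1 * \<theta>\<^sup>2) * u + (of_int t + of_int s * \<theta>\<^sup>2)"
      by (simp add: f_def algebra_simps)
    then have "algebraic_int u" by (rule algebraic_int_quadratic_over_base)
    then have "algebraic_int (0 + 0 * \<theta> + 1 / 2 * \<theta>\<^sup>2 + 1 / 2 * \<theta> ^ 3)"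
      by (simp add: u_def f_def add_divide_distrib algebra_simps power2_eq_square power3_eq_cube)
    from half_coord_contra[OF pb _ _ _ this] show False by auto
  qed
  have n11: "\<not> (a mod 4 = 1 \<and> b mod 4 = 1)"
  proof
    assume *: "a mod 4 = 1 \<and> b mod 4 = 1"
    obtain i j where ij: "a = 4 * i + 1" "b = 4 * j + 1"
      using * by (metis mult_div_mod_eq)
    \<comment> \<open>Modulo 2 the quartic is (X^2 + X + 1)^2; the numerator is one of the two
      factors at \<theta>.\<close>
    define u where "u = (1 + f + \<theta>) / 2"
    have "u\<^sup>2 - (1 + f) * u = (\<theta>\<^sup>2 - (1 + 2 * f + f * f)) / 4"
      by (simp add: u_def power2_eq_square field_simps)
    also have "\<dots> = of_int j + of_int i * f"
      unfolding ff f_def[symmetric] ij by (simp add: field_simps)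
    finally have "u\<^sup>2 = (of_int 1 + of_int 1 * \<theta>\<^sup>2) * u + (of_int j + of_int i * \<theta>\<^sup>2)"
      by (simp add: f_def algebra_simps)
    then have "algebraic_int u" by (rule algebraic_int_quadratic_over_base)
    then have "algebraic_int (1 / 2 + 1 / 2 * \<theta> + 1 / 2 * \<theta>\<^sup>2 + 0 * \<theta> ^ 3)"
      by (simp add: u_def f_def add_divide_distrib algebra_simps)
    from half_coord_contra[OF pb _ _ _ this] show False by auto
  qed
  have "a mod 4 = 0 \<or> a mod 4 = 1 \<or> a mod 4 = 2 \<or> a mod 4 = 3" by presburger
  moreover have "b mod 4 = 1 \<or> b mod 4 = 2 \<or> b mod 4 = 3" using b0 by presburger
  ultimately show ?thesis
    using n21 n03 n12 n11 by (elim disjE) (simp_all add: biquadratic_residues_def)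
qed

lemma power_basis_integral_iff:
  assumes "b \<noteq> 0"
  shows "power_basis_integral \<longleftrightarrow>
    squarefree b \<and> squarefree (reduced_discriminant a b) \<and> (a mod 4, b mod 4) \<in> biquadratic_residues"
  using power_basis_integral_if quadratic_maximal_if squarefree_b_if_integral[OF _ assms]
    squarefree_discriminant_if_integral residues_if_integral[OF _ assms] by blast

end

lemma complex_roots_iff: "z \<in> complex_roots [:b, 0, a, 0, 1:] \<longleftrightarrow> z ^ 4 + of_int a * z\<^sup>2 + of_int b = 0"
  by (simp add: complex_roots_def map_poly_pCons algebra_simps power2_eq_square power4_eq_xxxx)

lemma complex_roots_nonempty: "complex_roots [:b, 0, a, 0, 1:] \<noteq> {}"
proof -
  have "\<not> constant (poly (map_poly complex_of_int [:b, 0, a, 0, 1:]))"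
    by (simp add: constant_degree)
  then obtain \<theta> where "poly (map_poly complex_of_int [:b, 0, a, 0, 1:]) \<theta> = 0"
    using fundamental_theorem_of_algebra by blast
  then show ?thesis unfolding complex_roots_def by blast
qed

lemma monogenic_biquadratic_iff:
  assumes irred: "Factorial_Ring.irreducible (map_poly rat_of_int [:b, 0, a, 0, 1:])" and "b \<noteq> 0"
  shows "monogenic [:b, 0, a, 0, 1:] \<longleftrightarrow>
    squarefree b \<and> squarefree (reduced_discriminant a b) \<and> (a mod 4, b mod 4) \<in> biquadratic_residues"
proof -
  let ?C = "squarefree b \<and> squarefree (reduced_discriminant a b) \<and> (a mod 4, b mod 4) \<in> biquadratic_residues"
  let ?g = "[:b, 0, a, 0, 1:]"
  have *: "is_int_basis {\<theta> ^ i | i. i < Polynomial.degree ?g} (ring_of_integers (rat_adjoin {\<theta>})) \<longleftrightarrow> ?C"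
    if "\<theta> \<in> complex_roots ?g" for \<theta>
  proof -
    interpret irreducible_biquadratic a b \<theta>
      using irred that by unfold_locales (simp_all add: complex_roots_iff)
    show ?thesis using is_int_basis_iff power_basis_integral_iff[OF \<open>b \<noteq> 0\<close>] by (simp add: eval_nat_numeral)
  qed
  \<comment> \<open>\<open>monogenic\<close> quantifies over all roots, so a root must exist before
    the condition can be extracted from it.\<close>
  obtain \<theta> where "\<theta> \<in> complex_roots ?g" using complex_roots_nonempty by blast
  then show ?thesis
    using * irred unfolding monogenic_def by auto
qed

section \<open>The transitive groups as symmetries of a square\<close>

text \<open>The labels 1, 2, 3, 4 are the vertices of a square in cyclic order; a symmetry is determined by
  the images of 1 and 2.\<close>

definition opp :: "nat \<Rightarrow> nat" where
  "opp n = (if n = 1 then 3 else if n = 2 then 4 else if n = 3 then 1 else if n = 4 then 2 else n)"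

definition sq_perm :: "nat \<Rightarrow> nat \<Rightarrow> nat \<Rightarrow> nat" where
  "sq_perm x y n = (if n = 1 then x else if n = 2 then y else if n = 3 then opp x else if n = 4 then opp y else n)"

lemma opp_opp [simp]: "opp (opp n) = n"
  by (simp add: opp_def)

lemma sq_perm_simps [simp]:
  "sq_perm x y (Suc 0) = x" "sq_perm x y 2 = y" "sq_perm x y 3 = opp x" "sq_perm x y 4 = opp y"
  "opp (Suc 0) = 3" "opp 2 = 4" "opp 3 = Suc 0" "opp 4 = 2"
  by (simp_all add: sq_perm_def opp_def)

lemma sq_perm_outside: "n \<notin> {1..4} \<Longrightarrow> sq_perm x y n = n"
  by (auto simp: sq_perm_def)

lemma sq_perm_opp: "sq_perm x y (opp n) = opp (sq_perm x y n)"
  by (auto simp: sq_perm_def opp_def)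

lemma sq_perm_comp: "sq_perm x y \<circ> sq_perm u v = sq_perm (sq_perm x y u) (sq_perm x y v)"
proof
  fix n :: nat
  consider "n = 1" | "n = 2" | "n = 3" | "n = 4" | "n \<notin> {1..4}" by force
  then show "(sq_perm x y \<circ> sq_perm u v) n = sq_perm (sq_perm x y u) (sq_perm x y v) n"
    by cases (simp_all add: sq_perm_opp sq_perm_outside)
qed

lemma sq_perm_id: "sq_perm 1 2 = id"
proof
  fix n :: nat
  consider "n = 1" | "n = 2" | "n = 3" | "n = 4" | "n \<notin> {1..4}" by force
  then show "sq_perm 1 2 n = id n"
    by cases (simp_all add: sq_perm_outside)
qed

lemma sq_perm_eq_iff: "sq_perm x y = sq_perm u v \<longleftrightarrow> x = u \<and> y = v"
  by (metis sq_perm_simps(1,2))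

text \<open>The ordered pairs of adjacent vertices, that is, all possible images of (1, 2) under a
  symmetry of the square.\<close>

definition square_pairs :: "(nat \<times> nat) set" where
  "square_pairs = {(1,2), (1,4), (3,2), (3,4), (2,1), (2,3), (4,1), (4,3)}"

lemma nat_1_4: "{1..4::nat} = {1, 2, 3, 4}" by auto

lemma sq_perm_permutes:
  assumes "(x, y) \<in> square_pairs"
  shows "sq_perm x y permutes {1..4}"
proof -
  have "\<forall>(x, y)\<in>square_pairs. \<exists>(u, v)\<in>square_pairs.
      sq_perm x y u = 1 \<and> sq_perm x y v = 2 \<and> sq_perm u v x = 1 \<and> sq_perm u v y = 2"
    by (simp add: square_pairs_def)
  then obtain u v where "sq_perm x y u = 1" "sq_perm x y v = 2" "sq_perm u v x = 1" "sq_perm u v y = 2"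
    using assms by blast
  then have "sq_perm u v \<circ> sq_perm x y = id" "sq_perm x y \<circ> sq_perm u v = id"
    by (simp_all only: sq_perm_comp sq_perm_id)
  then have "bij (sq_perm x y)" by (rule o_bij)
  then show ?thesis using sq_perm_outside by (auto simp: permutes_def bij_iff)
qed

lemma cycles_eq_sq_perm:
  "cycle_of_list [1, 2, 3, 4] = sq_perm 2 3" "cycle_of_list [1, 3] = sq_perm 3 2"
  "cycle_of_list [1, 4] \<circ> cycle_of_list [2, 3] = sq_perm 4 3"
  "cycle_of_list [1, 2] \<circ> cycle_of_list [3, 4] = sq_perm 2 1"
  by (auto simp: fun_eq_iff sq_perm_def opp_def Transposition.transpose_def)

text \<open>Closure under products and inverses makes the set a subgroup, which bounds the generated
  group from above; \<open>gen\<close> bounds it from below. Stated on pairs, the closure conditions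
  become finite checks.\<close>

lemma perm_group4_structure:
  assumes S: "S \<subseteq> case_prod sq_perm ` P" and P: "P \<subseteq> square_pairs"
    and gen: "case_prod sq_perm ` P \<subseteq> generate (sym_group 4) S"
    and one: "(1, 2) \<in> P"
    and closed: "\<forall>(x, y)\<in>P. \<forall>(u, v)\<in>P. (sq_perm x y u, sq_perm x y v) \<in> P"
    and inverse: "\<forall>(u, v)\<in>P. \<exists>(x, y)\<in>P. sq_perm x y u = 1 \<and> sq_perm x y v = 2"
  shows "carrier (perm_group4 S) = case_prod sq_perm ` P"
proof -
  interpret G: group "sym_group 4" by (rule sym_group_is_group)
  have car: "case_prod sq_perm ` P \<subseteq> carrier (sym_group 4)"
    using P sq_perm_permutes by (auto simp: sym_group_carrier)
  have "subgroup (case_prod sq_perm ` P) (sym_group 4)"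
  proof (rule G.subgroupI)
    show "case_prod sq_perm ` P \<noteq> {}" using one by auto
  next
    fix p assume p: "p \<in> case_prod sq_perm ` P"
    then obtain u v where uv: "(u, v) \<in> P" "p = sq_perm u v" by auto
    then obtain x y where xy: "(x, y) \<in> P" "sq_perm x y u = 1" "sq_perm x y v = 2"
      using inverse by blast
    have "sq_perm x y \<circ> p = id"
      unfolding uv(2) sq_perm_comp xy sq_perm_id ..
    then have "inv\<^bsub>sym_group 4\<^esub> p = sq_perm x y"
      using car p xy(1) by (intro G.inv_equality) (auto simp: sym_group_mult sym_group_one)
    then show "inv\<^bsub>sym_group 4\<^esub> p \<in> case_prod sq_perm ` P" using xy(1) by (auto intro!: image_eqI[of _ _ "(x, y)"])
  next
    fix p q assume "p \<in> case_prod sq_perm ` P" "q \<in> case_prod sq_perm ` P"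
    then obtain x y u v where xy: "(x, y) \<in> P" "(u, v) \<in> P" "p = sq_perm x y" "q = sq_perm u v" by auto
    then have "(sq_perm x y u, sq_perm x y v) \<in> P" using closed by blast
    then show "p \<otimes>\<^bsub>sym_group 4\<^esub> q \<in> case_prod sq_perm ` P"
      unfolding sym_group_mult xy(3,4) sq_perm_comp by (intro image_eqI) auto
  qed (use car in auto)
  then have "generate (sym_group 4) S \<subseteq> case_prod sq_perm ` P"
    by (rule G.generate_subgroup_incl[OF S])
  then show ?thesis using gen by (simp add: perm_group4_def)
qed

lemma generate_sym_group_comp:
  "p \<in> generate (sym_group 4) S \<Longrightarrow> q \<in> generate (sym_group 4) S \<Longrightarrow> p \<circ> q \<in> generate (sym_group 4) S"
  using generate.eng[of p "sym_group 4" S q] by (simp add: sym_group_mult)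

lemma generate_sym_group_sq_perm:
  assumes "sq_perm x y \<in> generate (sym_group 4) S" "sq_perm u v \<in> generate (sym_group 4) S"
    "sq_perm x y u = z" "sq_perm x y v = w"
  shows "sq_perm z w \<in> generate (sym_group 4) S"
  using generate_sym_group_comp[OF assms(1,2)] assms(3,4) by (simp add: sq_perm_comp)

lemma generate_sym_group_one: "sq_perm 1 2 \<in> generate (sym_group 4) S"
  unfolding sq_perm_id using generate.one[of "sym_group 4" S] by (simp only: sym_group_one)

text \<open>The rotations of the square.\<close>

definition cyclic_pairs :: "(nat \<times> nat) set" where
  "cyclic_pairs = {(1,2), (2,3), (3,4), (4,1)}"

text \<open>The identity, the half turn and the two reflections without fixed vertices: the
  transitive Klein four-group, as opposed to the one containing the diagonal reflections.\<close>

definition klein_pairs :: "(nat \<times> nat) set" where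
  "klein_pairs = {(1,2), (4,3), (2,1), (3,4)}"

lemma rotations_in_generate:
  assumes "sq_perm 2 3 \<in> generate (sym_group 4) S"
  shows "sq_perm 3 4 \<in> generate (sym_group 4) S" "sq_perm 4 1 \<in> generate (sym_group 4) S"
proof -
  show *: "sq_perm 3 4 \<in> generate (sym_group 4) S"
    by (rule generate_sym_group_sq_perm[OF assms assms]) simp_all
  show "sq_perm 4 1 \<in> generate (sym_group 4) S"
    by (rule generate_sym_group_sq_perm[OF assms *]) simp_all
qed

lemma carrier_T4_1: "carrier T4_1 = case_prod sq_perm ` cyclic_pairs"
  unfolding T4_1_def cycles_eq_sq_perm
proof (rule perm_group4_structure)
  let ?G = "generate (sym_group 4) {sq_perm 2 3}"
  have "sq_perm 2 3 \<in> ?G" by (rule generate.incl) simp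
  note this rotations_in_generate[OF this] generate_sym_group_one[of "{sq_perm 2 3}"]
  then show "case_prod sq_perm ` cyclic_pairs \<subseteq> ?G" by (auto simp: cyclic_pairs_def)
qed (simp_all add: cyclic_pairs_def square_pairs_def)

lemma carrier_T4_2: "carrier T4_2 = case_prod sq_perm ` klein_pairs"
  unfolding T4_2_def cycles_eq_sq_perm
proof (rule perm_group4_structure)
  let ?G = "generate (sym_group 4) {sq_perm 4 3, sq_perm 2 1}"
  have *: "sq_perm 4 3 \<in> ?G" "sq_perm 2 1 \<in> ?G" by (rule generate.incl; simp)+
  have "sq_perm 3 4 \<in> ?G" by (rule generate_sym_group_sq_perm[OF *]) simp_all
  with * generate_sym_group_one[of "{sq_perm 4 3, sq_perm 2 1}"]
  show "case_prod sq_perm ` klein_pairs \<subseteq> ?G" by (auto simp: klein_pairs_def)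
qed (simp_all add: klein_pairs_def square_pairs_def)

lemma carrier_T4_3: "carrier T4_3 = case_prod sq_perm ` square_pairs"
  unfolding T4_3_def cycles_eq_sq_perm
proof (rule perm_group4_structure)
  let ?G = "generate (sym_group 4) {sq_perm 2 3, sq_perm 3 2}"
  have *: "sq_perm 2 3 \<in> ?G" "sq_perm 3 2 \<in> ?G" by (rule generate.incl; simp)+
  note r = rotations_in_generate[OF *(1)]
  have "sq_perm 4 3 \<in> ?G" by (rule generate_sym_group_sq_perm[OF *]) simp_all
  moreover have "sq_perm 1 4 \<in> ?G" by (rule generate_sym_group_sq_perm[OF r(1) *(2)]) simp_all
  moreover have "sq_perm 2 1 \<in> ?G" by (rule generate_sym_group_sq_perm[OF r(2) *(2)]) simp_all
  moreover note * r generate_sym_group_one[of "{sq_perm 2 3, sq_perm 3 2}"]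
  ultimately show "case_prod sq_perm ` square_pairs \<subseteq> ?G" by (auto simp: square_pairs_def)
qed (simp_all add: square_pairs_def)

lemma mult_T4: "monoid.mult T4_1 = (\<circ>)" "monoid.mult T4_2 = (\<circ>)" "monoid.mult T4_3 = (\<circ>)"
  by (simp_all add: T4_1_def T4_2_def T4_3_def perm_group4_def sym_group_mult)

section \<open>Invariants that tell the three groups apart\<close>

definition commutes :: "('a, 'b) monoid_scheme \<Rightarrow> bool" where
  "commutes G \<longleftrightarrow> (\<forall>x\<in>carrier G. \<forall>y\<in>carrier G. x \<otimes>\<^bsub>G\<^esub> y = y \<otimes>\<^bsub>G\<^esub> x)"

text \<open>Stated without the neutral element, so that it transfers along an isomorphism from a
  structure that is only known to be closed under multiplication.\<close>

definition involutive :: "('a, 'b) monoid_scheme \<Rightarrow> bool" where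
  "involutive G \<longleftrightarrow> (\<forall>x\<in>carrier G. \<forall>y\<in>carrier G. x \<otimes>\<^bsub>G\<^esub> (x \<otimes>\<^bsub>G\<^esub> y) = y)"

lemma iso_invariants:
  assumes "G \<cong> H" and closed: "\<And>x y. x \<in> carrier G \<Longrightarrow> y \<in> carrier G \<Longrightarrow> x \<otimes>\<^bsub>G\<^esub> y \<in> carrier G"
  shows "commutes G \<longleftrightarrow> commutes H" "involutive G \<longleftrightarrow> involutive H"
proof -
  obtain h where h: "h \<in> hom G H" "inj_on h (carrier G)" "carrier H = h ` carrier G"
    using assms(1) by (auto simp: is_iso_def iso_def bij_betw_def)
  have mult: "h x \<otimes>\<^bsub>H\<^esub> h y = h (x \<otimes>\<^bsub>G\<^esub> y)" if "x \<in> carrier G" "y \<in> carrier G" for x y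
    using h(1) that by (simp add: hom_def)
  have eq: "h x = h y \<longleftrightarrow> x = y" if "x \<in> carrier G" "y \<in> carrier G" for x y
    using h(2) that by (auto dest: inj_onD)
  show "commutes G \<longleftrightarrow> commutes H" "involutive G \<longleftrightarrow> involutive H"
    unfolding commutes_def involutive_def h(3) by (simp_all add: mult eq closed)
qed

lemma T4_invariants:
  "commutes T4_1" "\<not> involutive T4_1" "commutes T4_2" "involutive T4_2" "\<not> commutes T4_3"
  unfolding commutes_def involutive_def carrier_T4_1 carrier_T4_2 carrier_T4_3 mult_T4
  by (auto simp: cyclic_pairs_def klein_pairs_def square_pairs_def sq_perm_comp sq_perm_eq_iff)

text \<open>Commutativity separates the dihedral group from the other two, and having exponent 2
  separates the Klein group from the cyclic one.\<close>

lemma not_isomorphic_T4: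
  assumes closed: "\<And>x y. x \<in> carrier G \<Longrightarrow> y \<in> carrier G \<Longrightarrow> x \<otimes>\<^bsub>G\<^esub> y \<in> carrier G"
  shows "G \<cong> T4_1 \<Longrightarrow> \<not> G \<cong> T4_2" "G \<cong> T4_1 \<Longrightarrow> \<not> G \<cong> T4_3" "G \<cong> T4_2 \<Longrightarrow> \<not> G \<cong> T4_3"
  using iso_invariants[OF _ closed] T4_invariants by blast+

section \<open>The Galois group\<close>

locale biquadratic_roots = irreducible_biquadratic +
  fixes \<beta> :: complex
  assumes beta_sq: "\<beta>\<^sup>2 = - of_int a - \<theta>\<^sup>2"
begin

lemma theta_beta_sq: "(\<theta> * \<beta>)\<^sup>2 = of_int b"
proof -
  have "(\<theta> * \<beta>)\<^sup>2 = - of_int a * \<theta>\<^sup>2 - \<theta>\<^sup>2 * \<theta>\<^sup>2"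
    by (simp add: power_mult_distrib beta_sq algebra_simps)
  then show ?thesis unfolding theta_sq_sq by simp
qed

lemma nonzero: "\<theta> \<noteq> 0" "\<beta> \<noteq> 0" "\<theta>\<^sup>2 \<noteq> \<beta>\<^sup>2"
proof -
  show "\<theta> \<noteq> 0" using theta_notin number_subfieldD(1)[OF number_subfield_base, of 0] by auto
  show "\<beta> \<noteq> 0"
  proof
    assume "\<beta> = 0"
    then have "of_int a + 0 * \<theta> + 1 * \<theta>\<^sup>2 + 0 * \<theta> ^ 3 = 0" using beta_sq by (simp add: algebra_simps)
    from powers_independent[OF _ _ _ _ this] show False by simp
  qed
  show "\<theta>\<^sup>2 \<noteq> \<beta>\<^sup>2"
  proof
    assume "\<theta>\<^sup>2 = \<beta>\<^sup>2"
    then have "of_int a + 0 * \<theta> + 2 * \<theta>\<^sup>2 + 0 * \<theta> ^ 3 = 0" using beta_sq by (simp add: algebra_simps)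
    from powers_independent[OF _ _ _ _ this] show False by simp
  qed
qed

text \<open>The two roots play symmetric roles, so facts proved for \<theta> can be reused for
  \<beta>.\<close>

lemma swap: "biquadratic_roots a b \<beta> \<theta>"
proof
  show "Factorial_Ring.irreducible (map_poly rat_of_int [:b, 0, a, 0, 1:])" by (rule irred)
  show "\<theta>\<^sup>2 = - of_int a - \<beta>\<^sup>2" by (simp add: beta_sq)
  have "\<beta> ^ 4 = \<beta>\<^sup>2 * \<beta>\<^sup>2" by simp
  also have "\<dots> = \<beta>\<^sup>2 * (- of_int a - \<theta>\<^sup>2)" by (simp only: beta_sq)
  also have "\<dots> = - of_int a * \<beta>\<^sup>2 - (\<theta> * \<beta>)\<^sup>2" by (simp add: algebra_simps)
  finally show "\<beta> ^ 4 + of_int a * \<beta>\<^sup>2 + of_int b = 0" by (simp add: theta_beta_sq)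
qed

lemma complex_roots_eq: "complex_roots [:b, 0, a, 0, 1:] = {\<theta>, \<beta>, - \<theta>, - \<beta>}"
proof -
  have "z ^ 4 + of_int a * z\<^sup>2 + of_int b = (z\<^sup>2 - \<theta>\<^sup>2) * (z\<^sup>2 - \<beta>\<^sup>2)" for z
  proof -
    have "(z\<^sup>2 - \<theta>\<^sup>2) * (z\<^sup>2 - \<beta>\<^sup>2) = z ^ 4 - (\<theta>\<^sup>2 + \<beta>\<^sup>2) * z\<^sup>2 + (\<theta> * \<beta>)\<^sup>2"
      by (simp add: power2_eq_square power4_eq_xxxx algebra_simps)
    then show ?thesis by (simp add: theta_beta_sq) (simp add: beta_sq)
  qed
  then show ?thesis by (auto simp: complex_roots_iff power2_eq_iff)
qed

definition splitting_field :: "complex set" where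
  "splitting_field = rat_adjoin {\<theta>, \<beta>, - \<theta>, - \<beta>}"

lemma number_subfield_splitting: "number_subfield splitting_field"
  unfolding splitting_field_def by (rule number_subfield_rat_adjoin)

lemma roots_in_splitting:
  "\<theta> \<in> splitting_field" "\<beta> \<in> splitting_field" "- \<theta> \<in> splitting_field" "- \<beta> \<in> splitting_field"
  using rat_adjoin_superset[of "{\<theta>, \<beta>, - \<theta>, - \<beta>}"] by (auto simp: splitting_field_def)

lemma splitting_field_least:
  assumes "number_subfield K" "\<theta> \<in> K" "\<beta> \<in> K"
  shows "splitting_field \<subseteq> K"
  unfolding splitting_field_def using assms number_subfieldD(5)[OF assms(1)]
  by (intro rat_adjoin_least) auto

abbreviation G :: "(complex \<Rightarrow> complex) monoid" where
  "G \<equiv> galois_group [:b, 0, a, 0, 1:]"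

lemma carrier_G: "\<sigma> \<in> carrier G \<longleftrightarrow>
    \<sigma> \<in> extensional splitting_field \<and> bij_betw \<sigma> splitting_field splitting_field \<and> number_field_hom splitting_field \<sigma>"
  unfolding galois_group_def Let_def complex_roots_eq splitting_field_def[symmetric]
  using number_subfieldD(1)[OF number_subfield_splitting]
  by (auto simp: Bij_def Ring.ring_hom_def number_field_hom_def ring_of_type_algebra_complex bij_betw_def)

lemma mult_G: "\<sigma> \<in> carrier G \<Longrightarrow> \<tau> \<in> carrier G \<Longrightarrow> \<sigma> \<otimes>\<^bsub>G\<^esub> \<tau> = compose splitting_field \<sigma> \<tau>"
  unfolding galois_group_def Let_def complex_roots_eq splitting_field_def[symmetric]
  by (simp add: BijGroup_def)

lemma closed_G:
  assumes "\<sigma> \<in> carrier G" "\<tau> \<in> carrier G"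
  shows "\<sigma> \<otimes>\<^bsub>G\<^esub> \<tau> \<in> carrier G"
proof -
  have in_K: "\<tau> x \<in> splitting_field" if "x \<in> splitting_field" for x
    using assms(2) that by (auto simp: carrier_G bij_betw_def)
  have h: "number_field_hom splitting_field \<sigma>" "number_field_hom splitting_field \<tau>"
    using assms by (auto simp: carrier_G)
  have "number_field_hom splitting_field (compose splitting_field \<sigma> \<tau>)"
    using number_subfieldD(1,2,3)[OF number_subfield_splitting] in_K
    by (simp add: number_field_hom_def compose_def number_field_homD[OF h(1)] number_field_homD[OF h(2)])
  moreover have "bij_betw (compose splitting_field \<sigma> \<tau>) splitting_field splitting_field"
    using assms by (auto simp: carrier_G intro: bij_betw_compose)
  ultimately show ?thesis using mult_G[OF assms] by (simp add: carrier_G)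
qed

text \<open>The set where two embeddings agree is a subfield; if it contains \<theta> and \<beta> it
  is everything.\<close>

lemma hom_agree:
  assumes h: "number_field_hom splitting_field \<sigma>" "number_field_hom splitting_field \<tau>"
    and "\<sigma> \<theta> = \<tau> \<theta>" "\<sigma> \<beta> = \<tau> \<beta>" and "x \<in> splitting_field"
  shows "\<sigma> x = \<tau> x"
proof -
  note D = number_subfieldD[OF number_subfield_splitting]
  have "number_subfield {x \<in> splitting_field. \<sigma> x = \<tau> x}"
    unfolding number_subfield_def using D(1-4)
    by (auto simp: number_field_homD[OF h(1)] number_field_homD[OF h(2)]
      number_field_hom_simps(4)[OF h(1) number_subfield_splitting]
      number_field_hom_simps(4)[OF h(2) number_subfield_splitting])
  from splitting_field_least[OF this] assms(3-5) roots_in_splitting show ?thesis by auto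
qed

lemma hom_root_sq:
  assumes h: "number_field_hom splitting_field \<tau>"
  shows "(\<tau> \<theta>) ^ 4 + of_int a * (\<tau> \<theta>)\<^sup>2 + of_int b = 0" "(\<tau> \<beta>)\<^sup>2 = - of_int a - (\<tau> \<theta>)\<^sup>2"
proof -
  note D = number_subfieldD[OF number_subfield_splitting]
  note hs = number_field_homD[OF h] number_field_hom_simps[OF h number_subfield_splitting]
  have "\<tau> (\<theta> ^ 4 + of_int a * \<theta>\<^sup>2 + of_int b) = \<tau> 0" using root by simp
  then show "(\<tau> \<theta>) ^ 4 + of_int a * (\<tau> \<theta>)\<^sup>2 + of_int b = 0"
    using roots_in_splitting by (simp add: hs D)
  have "\<tau> (\<beta>\<^sup>2) = \<tau> (- of_int a - \<theta>\<^sup>2)" using beta_sq by simp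
  then show "(\<tau> \<beta>)\<^sup>2 = - of_int a - (\<tau> \<theta>)\<^sup>2"
    using roots_in_splitting by (simp add: hs D)
qed

text \<open>Normality of the splitting field: an embedding maps the finite set of roots injectively
  into itself, hence onto it, so its image contains generators of the field. The image of \<beta> is
  controlled by \<open>swap\<close>. Restricting makes the map extensional.\<close>

lemma restrict_in_G:
  assumes h: "number_field_hom splitting_field \<tau>"
  shows "restrict \<tau> splitting_field \<in> carrier G"
proof -
  note D = number_subfieldD[OF number_subfield_splitting]
  note hs = number_field_hom_simps[OF h number_subfield_splitting]
  let ?R = "{\<theta>, \<beta>, - \<theta>, - \<beta>}"
  have th: "\<tau> \<theta> \<in> ?R"
    using hom_root_sq(1)[OF h] complex_roots_eq by (metis complex_roots_iff)
  have be: "\<tau> \<beta> \<in> ?R"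
  proof -
    interpret S: biquadratic_roots a b \<beta> \<theta> by (rule swap)
    have "splitting_field = S.splitting_field"
      by (simp add: splitting_field_def S.splitting_field_def insert_commute)
    then have "\<tau> \<beta> \<in> complex_roots [:b, 0, a, 0, 1:]"
      using S.hom_root_sq(1)[of \<tau>] h by (simp add: complex_roots_iff)
    then show ?thesis by (simp only: complex_roots_eq)
  qed
  have sub: "\<tau> ` ?R \<subseteq> ?R"
    using th be roots_in_splitting by (auto simp: hs(1))
  have inj: "inj_on \<tau> splitting_field"
    by (rule number_field_hom_inj[OF h number_subfield_splitting])
  have "inj_on \<tau> ?R" by (rule inj_on_subset[OF inj]) (use roots_in_splitting in auto)
  then have surj: "\<tau> ` ?R = ?R" by (intro endo_inj_surj sub) auto
  have "splitting_field \<subseteq> \<tau> ` splitting_field"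
  proof -
    have "?R \<subseteq> \<tau> ` splitting_field" using surj roots_in_splitting by blast
    then show ?thesis
      by (intro splitting_field_least number_subfield_image[OF h number_subfield_splitting]) auto
  qed
  moreover have "\<tau> ` splitting_field \<subseteq> splitting_field"
  proof -
    have "number_subfield {x \<in> splitting_field. \<tau> x \<in> splitting_field}"
      unfolding number_subfield_def using D(1-4)
      by (auto simp: number_field_homD[OF h] hs(4))
    then have "splitting_field \<subseteq> {x \<in> splitting_field. \<tau> x \<in> splitting_field}"
      by (rule splitting_field_least) (use th be roots_in_splitting in auto)
    then show ?thesis by auto
  qed
  ultimately have "bij_betw \<tau> splitting_field splitting_field"
    using inj by (auto simp: bij_betw_def)
  moreover have "number_field_hom splitting_field (restrict \<tau> splitting_field)"
    using D(1-3) by (simp add: number_field_hom_def number_field_homD[OF h])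
  ultimately show ?thesis by (simp add: carrier_G)
qed

text \<open>Opposite vertices carry opposite roots, so compatibility with negation becomes
  preservation of the square. The last branch also catches labels outside 1 to 4, whence the range
  conditions below.\<close>

definition vertex_root :: "nat \<Rightarrow> complex" where
  "vertex_root n = (if n = 1 then \<theta> else if n = 2 then \<beta> else if n = 3 then - \<theta> else - \<beta>)"

lemma vertex_root_simps [simp]:
  "vertex_root (Suc 0) = \<theta>" "vertex_root 2 = \<beta>" "vertex_root 3 = - \<theta>" "vertex_root 4 = - \<beta>"
  by (simp_all add: vertex_root_def)

lemma vertex_root_opp: "n \<in> {1..4} \<Longrightarrow> vertex_root (opp n) = - vertex_root n"
  unfolding nat_1_4 by auto

lemma vertex_root_inj: "inj_on vertex_root {1..4}"
proof -
  have "\<theta> \<noteq> \<beta>" "\<theta> \<noteq> - \<beta>" "\<beta> \<noteq> - \<theta>" "\<theta> \<noteq> - \<theta>" "\<beta> \<noteq> - \<beta>"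
    using nonzero by auto
  then show ?thesis unfolding nat_1_4 by (auto simp: inj_on_def)
qed

lemma vertex_root_eq_iff: "i \<in> {1..4} \<Longrightarrow> j \<in> {1..4} \<Longrightarrow> vertex_root i = vertex_root j \<longleftrightarrow> i = j"
  using vertex_root_inj by (auto dest: inj_onD)

lemma square_pairs_sum: "(i, j) \<in> square_pairs \<Longrightarrow> (vertex_root j)\<^sup>2 = - of_int a - (vertex_root i)\<^sup>2"
  by (auto simp: square_pairs_def beta_sq)

text \<open>The image of \<theta> is one of four roots, and it fixes the square of the image of
  \<beta>; only a sign remains.\<close>

lemma hom_root_pair:
  assumes h: "number_field_hom splitting_field \<tau>"
  obtains i j where "(i, j) \<in> square_pairs" "\<tau> \<theta> = vertex_root i" "\<tau> \<beta> = vertex_root j"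
proof -
  have "\<tau> \<theta> \<in> {\<theta>, \<beta>, - \<theta>, - \<beta>}"
    using hom_root_sq(1)[OF h] complex_roots_eq by (metis complex_roots_iff)
  then consider "\<tau> \<theta> = \<theta>" | "\<tau> \<theta> = \<beta>" | "\<tau> \<theta> = - \<theta>" | "\<tau> \<theta> = - \<beta>" by auto
  then show thesis
  proof cases
    case 1
    then have "\<tau> \<beta> = \<beta> \<or> \<tau> \<beta> = - \<beta>" using hom_root_sq(2)[OF h] by (simp add: beta_sq[symmetric] power2_eq_iff)
    then show thesis using 1 that[of 1 2] that[of 1 4] by (auto simp: square_pairs_def)
  next
    case 2
    then have "\<tau> \<beta> = \<theta> \<or> \<tau> \<beta> = - \<theta>" using hom_root_sq(2)[OF h] by (simp add: beta_sq power2_eq_iff)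
    then show thesis using 2 that[of 2 1] that[of 2 3] by (auto simp: square_pairs_def)
  next
    case 3
    then have "\<tau> \<beta> = \<beta> \<or> \<tau> \<beta> = - \<beta>" using hom_root_sq(2)[OF h] by (simp add: beta_sq[symmetric] power2_eq_iff)
    then show thesis using 3 that[of 3 2] that[of 3 4] by (auto simp: square_pairs_def)
  next
    case 4
    then have "\<tau> \<beta> = \<theta> \<or> \<tau> \<beta> = - \<theta>" using hom_root_sq(2)[OF h] by (simp add: beta_sq power2_eq_iff)
    then show thesis using 4 that[of 4 1] that[of 4 3] by (auto simp: square_pairs_def)
  qed
qed

text \<open>The isomorphism reads off the permutation of the labelled roots. \<open>pairs\<close>
  bounds the possible permutations from above and \<open>ex\<close> says that all of them occur, so
  each later case reduces to these two checks.\<close>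

lemma galois_group_iso:
  assumes T: "carrier T = case_prod sq_perm ` P" "monoid.mult T = (\<circ>)"
    and pairs: "\<And>\<tau> i j. number_field_hom splitting_field \<tau> \<Longrightarrow> (i, j) \<in> square_pairs \<Longrightarrow>
      \<tau> \<theta> = vertex_root i \<Longrightarrow> \<tau> \<beta> = vertex_root j \<Longrightarrow> (i, j) \<in> P"
    and "P \<subseteq> square_pairs"
    and ex: "\<And>i j. (i, j) \<in> P \<Longrightarrow> \<exists>\<tau>. number_field_hom splitting_field \<tau> \<and> \<tau> \<theta> = vertex_root i \<and> \<tau> \<beta> = vertex_root j"
  shows "G \<cong> T"
proof -
  have range: "i \<in> {1..4}" "j \<in> {1..4}" if "(i, j) \<in> square_pairs" for i j
    using that by (auto simp: square_pairs_def)
  define idx where "idx = inv_into {1..4} vertex_root"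
  have idx: "idx (vertex_root n) = n" if "n \<in> {1..4}" for n
    using vertex_root_inj that unfolding idx_def by (rule inv_into_f_f)
  define \<Phi> where "\<Phi> \<sigma> = sq_perm (idx (\<sigma> \<theta>)) (idx (\<sigma> \<beta>))" for \<sigma> :: "complex \<Rightarrow> complex"
  have \<Phi>: "\<exists>i j. (i, j) \<in> P \<and> \<sigma> \<theta> = vertex_root i \<and> \<sigma> \<beta> = vertex_root j \<and> \<Phi> \<sigma> = sq_perm i j"
    if h: "number_field_hom splitting_field \<sigma>" for \<sigma>
  proof -
    obtain i j where ij: "(i, j) \<in> square_pairs" "\<sigma> \<theta> = vertex_root i" "\<sigma> \<beta> = vertex_root j"
      using hom_root_pair[OF h] .
    then have "\<Phi> \<sigma> = sq_perm i j" by (simp only: \<Phi>_def ij(2,3) idx[OF range(1)[OF ij(1)]] idx[OF range(2)[OF ij(1)]])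
    then show ?thesis using pairs[OF h ij] ij by blast
  qed
  have act: "\<sigma> (vertex_root n) = vertex_root (sq_perm i j n) \<and> sq_perm i j n \<in> {1..4}"
    if "number_field_hom splitting_field \<sigma>" "(i, j) \<in> square_pairs" "\<sigma> \<theta> = vertex_root i" "\<sigma> \<beta> = vertex_root j" "n \<in> {1..4}"
    for \<sigma> i j n
  proof -
    have "n = 1 \<or> n = 2 \<or> n = 3 \<or> n = 4" using that(5) by auto
    moreover have "sq_perm i j n \<in> {1..4}"
      using sq_perm_permutes[OF that(2)] that(5) by (simp only: permutes_in_image)
    ultimately show ?thesis
      using that(1-4) roots_in_splitting range[OF that(2)]
      by (auto simp: number_field_hom_simps(1)[OF that(1) number_subfield_splitting] vertex_root_opp)
  qed
  have hom: "\<Phi> (\<sigma> \<otimes>\<^bsub>G\<^esub> \<tau>) = \<Phi> \<sigma> \<circ> \<Phi> \<tau>" if st: "\<sigma> \<in> carrier G" "\<tau> \<in> carrier G" for \<sigma> \<tau>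
  proof -
    have h: "number_field_hom splitting_field \<sigma>" "number_field_hom splitting_field \<tau>"
      using st by (auto simp: carrier_G)
    obtain i j where ij: "(i, j) \<in> P" "\<sigma> \<theta> = vertex_root i" "\<sigma> \<beta> = vertex_root j" "\<Phi> \<sigma> = sq_perm i j"
      using \<Phi>[OF h(1)] by blast
    obtain u v where uv: "(u, v) \<in> P" "\<tau> \<theta> = vertex_root u" "\<tau> \<beta> = vertex_root v" "\<Phi> \<tau> = sq_perm u v"
      using \<Phi>[OF h(2)] by blast
    have ij': "(i, j) \<in> square_pairs" and uv': "(u, v) \<in> square_pairs" using ij uv assms(4) by auto
    note act' = act[OF h(1) ij' ij(2,3)]
    have "(\<sigma> \<otimes>\<^bsub>G\<^esub> \<tau>) \<theta> = vertex_root (sq_perm i j u)" "(\<sigma> \<otimes>\<^bsub>G\<^esub> \<tau>) \<beta> = vertex_root (sq_perm i j v)"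
      using act'[OF range(1)[OF uv']] act'[OF range(2)[OF uv']] roots_in_splitting
      by (simp_all add: mult_G[OF st] compose_def uv)
    then have "\<Phi> (\<sigma> \<otimes>\<^bsub>G\<^esub> \<tau>) = sq_perm (sq_perm i j u) (sq_perm i j v)"
      using act'[OF range(1)[OF uv']] act'[OF range(2)[OF uv']] by (simp add: \<Phi>_def idx)
    then show ?thesis by (simp add: sq_perm_comp ij uv)
  qed
  have "\<Phi> \<in> hom G T"
    using \<Phi> hom by (fastforce simp: hom_def T carrier_G)
  moreover have "inj_on \<Phi> (carrier G)"
  proof (rule inj_onI)
    fix \<sigma> \<tau> assume st: "\<sigma> \<in> carrier G" "\<tau> \<in> carrier G" "\<Phi> \<sigma> = \<Phi> \<tau>"
    then have h: "number_field_hom splitting_field \<sigma>" "number_field_hom splitting_field \<tau>"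
      by (auto simp: carrier_G)
    have "\<sigma> \<theta> = \<tau> \<theta>" "\<sigma> \<beta> = \<tau> \<beta>"
      using \<Phi>[OF h(1)] \<Phi>[OF h(2)] st(3) by (auto simp: sq_perm_eq_iff)
    then show "\<sigma> = \<tau>"
      using hom_agree[OF h] st by (intro extensionalityI[of _ splitting_field]) (auto simp: carrier_G)
  qed
  moreover have "carrier T \<subseteq> \<Phi> ` carrier G"
  proof
    fix p assume "p \<in> carrier T"
    then obtain i j where ij: "(i, j) \<in> P" "p = sq_perm i j" by (auto simp: T)
    then obtain \<tau> where \<tau>: "number_field_hom splitting_field \<tau>" "\<tau> \<theta> = vertex_root i" "\<tau> \<beta> = vertex_root j"
      using ex by blast
    have ij': "(i, j) \<in> square_pairs" using ij(1) assms(4) by auto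
    have "\<Phi> (restrict \<tau> splitting_field) = p"
      using roots_in_splitting
      by (simp add: \<Phi>_def \<tau>(2,3) ij(2) idx[OF range(1)[OF ij']] idx[OF range(2)[OF ij']])
    then show "p \<in> \<Phi> ` carrier G" using restrict_in_G[OF \<tau>(1)] by blast
  qed
  ultimately have "\<Phi> \<in> iso G T"
    by (auto simp: iso_iff hom_def)
  then show ?thesis by (rule is_isoI)
qed

section \<open>Construction of embeddings and the three Galois groups\<close>

lemma base_hom:
  obtains \<tau> where "number_field_hom base_field \<tau>" "\<tau> (\<theta>\<^sup>2) = \<beta>\<^sup>2"
proof -
  have id: "number_field_hom \<rat> (\<lambda>x. x)" by (simp add: number_field_hom_def)
  have "sqrt_delta\<^sup>2 \<in> \<rat>" by (simp add: sqrt_delta_sq)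
  \<comment> \<open>Changing the sign of \<open>sqrt_delta\<close> is what exchanges the squares of
    \<theta> and \<beta>.\<close>
  then obtain \<tau> where \<tau>: "number_field_hom base_field \<tau>" "\<tau> sqrt_delta = - sqrt_delta"
    using number_field_hom_extend[OF id number_subfield_Rats sqrt_delta_notin, of "- sqrt_delta"]
    unfolding base_field_def by (metis power2_minus)
  note hs = number_field_homD[OF \<tau>(1)]
  note D = number_subfieldD[OF number_subfield_base]
  have "\<tau> sqrt_delta = \<tau> (2 * \<theta>\<^sup>2 + of_int a)" by (simp add: sqrt_delta_def)
  also have "\<dots> = 2 * \<tau> (\<theta>\<^sup>2) + of_int a" using theta_sq_in_base by (simp add: hs D)
  finally have "- sqrt_delta = 2 * \<tau> (\<theta>\<^sup>2) + of_int a" using \<tau>(2) by simp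
  then have "\<tau> (\<theta>\<^sup>2) = (- sqrt_delta - of_int a) / 2" by simp
  also have "\<dots> = \<beta>\<^sup>2" by (simp add: sqrt_delta_def beta_sq field_simps)
  finally show thesis using that \<tau>(1) by simp
qed

text \<open>One quadratic step above \<open>base_field\<close>: extend the identity when the target
  is \<theta> or -\<theta>, and the conjugation of \<open>base_hom\<close> when it is \<beta> or
  -\<beta>.\<close>

lemma adjoin_hom:
  assumes "i \<in> {1..4}"
  obtains \<tau> where "number_field_hom (rat_adjoin {\<theta>}) \<tau>" "\<tau> \<theta> = vertex_root i"
proof -
  have "\<exists>\<tau>. number_field_hom base_field \<tau> \<and> (vertex_root i)\<^sup>2 = \<tau> (\<theta>\<^sup>2)"
  proof (cases "i = 1 \<or> i = 3")
    case True
    then show ?thesis by (intro exI[of _ "\<lambda>x. x"]) (auto simp: number_field_hom_def)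
  next
    case False
    then have "(vertex_root i)\<^sup>2 = \<beta>\<^sup>2" by (simp add: vertex_root_def)
    then show ?thesis using base_hom by metis
  qed
  then obtain \<tau> where "number_field_hom base_field \<tau>" "(vertex_root i)\<^sup>2 = \<tau> (\<theta>\<^sup>2)" by blast
  then show thesis
    using number_field_hom_extend[OF _ number_subfield_base theta_notin theta_sq_in_base] that
    unfolding rat_adjoin_theta by metis
qed

text \<open>Since \<theta> and \<beta> have squares with rational sum, membership would give \<beta>
  a rational quadratic relation, contradicting independence of its powers.\<close>

lemma beta_notin_base: "\<beta> \<notin> base_field"
proof
  assume "\<beta> \<in> base_field"
  then obtain x y where xy: "x \<in> \<rat>" "y \<in> \<rat>" "\<beta> = x + y * \<theta>\<^sup>2" by (elim base_fieldE)
  interpret S: biquadratic_roots a b \<beta> \<theta> by (rule swap)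
  have "(x - y * of_int a) + (-1) * \<beta> + (- y) * \<beta>\<^sup>2 + 0 * \<beta> ^ 3 = 0"
    using xy(3) unfolding S.beta_sq by (simp add: algebra_simps)
  from S.powers_independent[OF _ _ _ _ this] xy(1,2) show False by simp
qed

lemma rational_sqrt_is_square:
  assumes "x \<in> \<rat>" "x\<^sup>2 = (of_int n :: complex)"
  shows "is_square n"
proof -
  have "algebraic_int x" by (rule algebraic_int_sqrtD) (simp add: assms(2))
  then obtain k where "x = of_int k" using assms(1) rational_algebraic_int_is_int by (auto elim!: Ints_cases)
  then have "of_int (k\<^sup>2) = (of_int n :: complex)" using assms(2) by simp
  then have "k\<^sup>2 = n" by (simp only: of_int_eq_iff)
  then show ?thesis by (auto simp: is_nth_power_def)
qed

text \<open>The same argument at two levels: if a square has no mixed term, one of the two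
  coordinates of its root vanishes. Applied to \<beta> over \<open>base_field\<close>, it puts
  \<theta> \<beta> into \<open>base_field\<close>; applied to \<theta> \<beta> over the rationals,
  it makes \<open>b\<close> either a rational square or \<delta> times one.\<close>

lemma beta_in_adjoin_imp_square:
  assumes "\<beta> \<in> rat_adjoin {\<theta>}"
  shows "is_square b \<or> is_square (b * (a\<^sup>2 - 4 * b))"
proof -
  note D = number_subfieldD[OF number_subfield_base]
  obtain x y where xy: "x \<in> base_field" "y \<in> base_field" "\<beta> = x + y * \<theta>"
    using assms by (auto simp: rat_adjoin_theta quad_ext_def)
  have "(x\<^sup>2 + y\<^sup>2 * \<theta>\<^sup>2) + (2 * x * y) * \<theta> = (- of_int a - \<theta>\<^sup>2) + 0 * \<theta>"
    unfolding beta_sq[symmetric] xy(3) by (simp add: power2_eq_square algebra_simps)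
  moreover have "x\<^sup>2 + y\<^sup>2 * \<theta>\<^sup>2 \<in> base_field" "- of_int a - \<theta>\<^sup>2 \<in> base_field" "0 \<in> base_field" "2 * x * y \<in> base_field"
    using xy theta_sq_in_base by (auto intro!: D(2,3,6,8) intro: D(1))
  ultimately have "2 * x * y = 0"
    using quad_ext_coords(2)[OF number_subfield_base theta_notin] by blast
  moreover have "y \<noteq> 0" using xy beta_notin_base by auto
  ultimately have "x = 0" by simp
  then have "\<theta> * \<beta> = y * \<theta>\<^sup>2" using xy(3) by (simp add: power2_eq_square)
  then have "\<theta> * \<beta> \<in> base_field" using xy(2) theta_sq_in_base D(3) by simp
  then obtain m n where mn: "m \<in> \<rat>" "n \<in> \<rat>" "\<theta> * \<beta> = m + n * sqrt_delta"
    by (auto simp: base_field_def quad_ext_def)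
  have "(m + n * sqrt_delta)\<^sup>2 = (m\<^sup>2 + n\<^sup>2 * sqrt_delta\<^sup>2) + (2 * m * n) * sqrt_delta"
    by (simp add: power2_eq_square algebra_simps)
  then have eq: "(m\<^sup>2 + n\<^sup>2 * of_int (a\<^sup>2 - 4 * b)) + (2 * m * n) * sqrt_delta = of_int b + 0 * sqrt_delta"
    using theta_beta_sq unfolding mn(3) sqrt_delta_sq by simp
  then have *: "m\<^sup>2 + n\<^sup>2 * of_int (a\<^sup>2 - 4 * b) = of_int b" "2 * m * n = 0"
    using quad_ext_coords[OF number_subfield_Rats sqrt_delta_notin _ _ _ _ eq] mn(1,2) by auto
  from *(2) consider "n = 0" | "m = 0" by auto
  then show ?thesis
  proof cases
    case 1
    then show ?thesis using rational_sqrt_is_square[of m b] mn(1) *(1) by simp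
  next
    case 2
    then have b: "of_int b = n\<^sup>2 * of_int (a\<^sup>2 - 4 * b)" using *(1) by simp
    have "(n * of_int (a\<^sup>2 - 4 * b))\<^sup>2 = of_int b * of_int (a\<^sup>2 - 4 * b)"
      unfolding b by (simp add: power2_eq_square)
    then have "(n * of_int (a\<^sup>2 - 4 * b))\<^sup>2 = of_int (b * (a\<^sup>2 - 4 * b))" by simp
    moreover have "n * of_int (a\<^sup>2 - 4 * b) \<in> \<rat>" using mn(2) by (intro Rats_mult Rats_of_int)
    ultimately show ?thesis using rational_sqrt_is_square by blast
  qed
qed

lemma splitting_eq_adjoin:
  assumes "\<beta> \<in> rat_adjoin {\<theta>}"
  shows "splitting_field = rat_adjoin {\<theta>}"
proof
  show "splitting_field \<subseteq> rat_adjoin {\<theta>}"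
    using assms rat_adjoin_superset by (intro splitting_field_least number_subfield_rat_adjoin) auto
  show "rat_adjoin {\<theta>} \<subseteq> splitting_field"
    using roots_in_splitting by (intro rat_adjoin_least number_subfield_splitting) auto
qed

text \<open>If \<theta> already generates the splitting field, \<open>adjoin_hom\<close> realises
  every image of \<theta>. As \<open>P\<close> holds at most one pair for each such image, the image
  of \<beta> is then forced, and existence needs no separate argument.\<close>

lemma galois_group_iso_if_simple:
  assumes T: "carrier T = case_prod sq_perm ` P" "monoid.mult T = (\<circ>)"
    and pairs: "\<And>\<tau> i j. number_field_hom splitting_field \<tau> \<Longrightarrow> (i, j) \<in> square_pairs \<Longrightarrow>
      \<tau> \<theta> = vertex_root i \<Longrightarrow> \<tau> \<beta> = vertex_root j \<Longrightarrow> (i, j) \<in> P"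
    and P: "P \<subseteq> square_pairs" "\<And>i j j'. (i, j) \<in> P \<Longrightarrow> (i, j') \<in> P \<Longrightarrow> j = j'"
    and \<beta>: "\<beta> \<in> rat_adjoin {\<theta>}"
  shows "G \<cong> T"
proof (rule galois_group_iso[OF T pairs P(1)])
  fix i j assume ij: "(i, j) \<in> P"
  then have i: "i \<in> {1..4}" using P(1) by (auto simp: square_pairs_def)
  obtain \<tau> where \<tau>: "number_field_hom splitting_field \<tau>" "\<tau> \<theta> = vertex_root i"
    using adjoin_hom[OF i] unfolding splitting_eq_adjoin[OF \<beta>] .
  obtain i' j' where ij': "(i', j') \<in> square_pairs" "\<tau> \<theta> = vertex_root i'" "\<tau> \<beta> = vertex_root j'"
    using hom_root_pair[OF \<tau>(1)] .
  have "i' \<in> {1..4}" using ij'(1) by (auto simp: square_pairs_def)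
  then have "i' = i" using ij'(2) \<tau>(2) i by (simp add: vertex_root_eq_iff)
  then have "j' = j" using P(2)[OF ij] pairs[OF \<tau>(1) ij'] by simp
  then show "\<exists>\<tau>. number_field_hom splitting_field \<tau> \<and> \<tau> \<theta> = vertex_root i \<and> \<tau> \<beta> = vertex_root j"
    using \<tau> ij'(3) by blast
qed

text \<open>Every symmetry sends \<theta> \<beta> to itself or its negative;
  \<open>klein_pairs\<close> are those with the plus sign, which is forced once the product is
  rational.\<close>

lemma galois_group_klein:
  assumes "is_square b"
  shows "G \<cong> T4_2"
proof (rule galois_group_iso_if_simple[OF carrier_T4_2 mult_T4(2)])
  obtain k where "b = k\<^sup>2" using assms by (auto simp: is_nth_power_def)
  then have "(\<theta> * \<beta>)\<^sup>2 = (of_int k)\<^sup>2" using theta_beta_sq by simp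
  then have "\<theta> * \<beta> = of_int k \<or> \<theta> * \<beta> = - of_int k" by (simp only: power2_eq_iff)
  then have s: "\<theta> * \<beta> \<in> \<rat>" by auto
  have nz: "\<theta> * \<beta> \<noteq> 0" using nonzero by simp
  have "\<beta> = \<theta> * \<beta> / \<theta>" using nonzero by simp
  also have "\<dots> \<in> rat_adjoin {\<theta>}"
    using s rat_adjoin_superset[of "{\<theta>}"] number_subfieldD(1,7)[OF number_subfield_rat_adjoin[of "{\<theta>}"]] by blast
  finally show "\<beta> \<in> rat_adjoin {\<theta>}" .
  fix \<tau> i j assume h: "number_field_hom splitting_field \<tau>" and ij: "(i, j) \<in> square_pairs"
    "\<tau> \<theta> = vertex_root i" "\<tau> \<beta> = vertex_root j"
  have "\<tau> (\<theta> * \<beta>) = \<theta> * \<beta>" using number_field_homD(1)[OF h s] .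
  then have "vertex_root i * vertex_root j = \<theta> * \<beta>"
    using number_field_homD(3)[OF h] roots_in_splitting ij by simp
  then show "(i, j) \<in> klein_pairs"
    using ij(1) nz by (auto simp: square_pairs_def klein_pairs_def mult.commute)
qed (auto simp: klein_pairs_def square_pairs_def)

text \<open>The element \<open>c\<close> has square b \<delta>; rotations fix it and reflections
  negate it, so rationality of \<open>c\<close> leaves only rotations.\<close>

lemma galois_group_cyclic:
  assumes "is_square (b * (a\<^sup>2 - 4 * b))"
  shows "G \<cong> T4_1"
proof (rule galois_group_iso_if_simple[OF carrier_T4_1 mult_T4(1)])
  define c where "c = \<theta> * \<beta> * (\<theta>\<^sup>2 - \<beta>\<^sup>2)"
  have c: "c = \<theta> * \<beta> * sqrt_delta" by (simp add: c_def sqrt_delta_def beta_sq algebra_simps)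
  obtain k where k: "b * (a\<^sup>2 - 4 * b) = k\<^sup>2" using assms by (auto simp: is_nth_power_def)
  have "c\<^sup>2 = of_int (b * (a\<^sup>2 - 4 * b))"
    unfolding c power_mult_distrib[of _ sqrt_delta] theta_beta_sq sqrt_delta_sq by simp
  then have "c\<^sup>2 = (of_int k)\<^sup>2" unfolding k by simp
  then have "c = of_int k \<or> c = - of_int k" by (simp only: power2_eq_iff)
  then have cQ: "c \<in> \<rat>" by auto
  have nz: "c \<noteq> 0" using nonzero by (simp add: c_def)
  have "sqrt_delta \<noteq> 0" using sqrt_delta_notin by auto
  then have "\<beta> = c / (\<theta> * sqrt_delta)" using nonzero by (simp add: c)
  also have "\<dots> \<in> rat_adjoin {\<theta>}"
  proof -
    note D = number_subfieldD[OF number_subfield_rat_adjoin[of "{\<theta>}"]]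
    have \<theta>: "\<theta> \<in> rat_adjoin {\<theta>}" using rat_adjoin_superset by auto
    then have "sqrt_delta \<in> rat_adjoin {\<theta>}" unfolding sqrt_delta_def by (auto intro!: D(2,3,8) intro: D(1))
    then show ?thesis using \<theta> D(1)[OF cQ] D(3,7) by simp
  qed
  finally show "\<beta> \<in> rat_adjoin {\<theta>}" .
  fix \<tau> i j assume h: "number_field_hom splitting_field \<tau>" and ij: "(i, j) \<in> square_pairs"
    "\<tau> \<theta> = vertex_root i" "\<tau> \<beta> = vertex_root j"
  have "\<tau> c = c" using number_field_homD(1)[OF h cQ] .
  then have "vertex_root i * vertex_root j * ((vertex_root i)\<^sup>2 - (vertex_root j)\<^sup>2) = c"
    unfolding c_def using roots_in_splitting ij number_subfieldD(3,6,8)[OF number_subfield_splitting]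
    by (simp add: number_field_homD[OF h] number_field_hom_simps[OF h number_subfield_splitting])
  moreover have "vertex_root i * vertex_root j * ((vertex_root i)\<^sup>2 - (vertex_root j)\<^sup>2) = - c"
    if "(i, j) \<in> {(1,4), (3,2), (2,1), (4,3)}"
    using that by (elim insertE Pair_inject emptyE) (simp_all add: c_def algebra_simps)
  moreover have "c \<noteq> - c" using nz by simp
  ultimately have "(i, j) \<notin> {(1,4), (3,2), (2,1), (4,3)}" by metis
  then show "(i, j) \<in> cyclic_pairs"
    using ij(1) unfolding square_pairs_def cyclic_pairs_def by blast
qed (auto simp: cyclic_pairs_def square_pairs_def)

text \<open>Here \<beta> is not in the field of \<theta>, so the last quadratic step is genuine:
  each of the four images of \<theta> extends with both signs for \<beta>.\<close>

lemma galois_group_dihedral: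
  assumes "\<not> is_square b" "\<not> is_square (b * (a\<^sup>2 - 4 * b))"
  shows "G \<cong> T4_3"
proof (rule galois_group_iso[OF carrier_T4_3 mult_T4(3)])
  let ?M = "rat_adjoin {\<theta>}"
  note M = number_subfield_rat_adjoin[of "{\<theta>}"]
  have \<theta>: "\<theta> \<in> ?M" using rat_adjoin_superset by auto
  have \<beta>: "\<beta> \<notin> ?M" using beta_in_adjoin_imp_square assms by blast
  have \<beta>2: "\<beta>\<^sup>2 \<in> ?M" unfolding beta_sq using \<theta> by (auto intro!: number_subfieldD(6,8)[OF M] intro: number_subfieldD(1)[OF M])
  have K: "splitting_field = quad_ext ?M \<beta>"
  proof
    show "splitting_field \<subseteq> quad_ext ?M \<beta>"
      using quad_ext_superset[OF M] \<theta> by (intro splitting_field_least number_subfield_quad_ext[OF M \<beta>2]) auto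
    show "quad_ext ?M \<beta> \<subseteq> splitting_field"
      using roots_in_splitting
      by (intro quad_ext_least number_subfield_splitting rat_adjoin_least) auto
  qed
  fix i j assume ij: "(i, j) \<in> square_pairs"
  then have i: "i \<in> {1..4}" by (auto simp: square_pairs_def)
  obtain \<tau> where \<tau>: "number_field_hom ?M \<tau>" "\<tau> \<theta> = vertex_root i" using adjoin_hom[OF i] .
  have "\<tau> (\<beta>\<^sup>2) = - of_int a - (\<tau> \<theta>)\<^sup>2"
    unfolding beta_sq using \<theta> number_subfieldD(1,8)[OF M]
    by (simp add: number_field_hom_simps[OF \<tau>(1) M] number_field_homD[OF \<tau>(1)])
  then have "(vertex_root j)\<^sup>2 = \<tau> (\<beta>\<^sup>2)" using square_pairs_sum[OF ij] \<tau>(2) by simp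
  then obtain \<tau>' where "number_field_hom splitting_field \<tau>'" "\<tau>' \<theta> = vertex_root i" "\<tau>' \<beta> = vertex_root j"
    using number_field_hom_extend[OF \<tau>(1) M \<beta> \<beta>2] \<theta> \<tau>(2) unfolding K by metis
  then show "\<exists>\<tau>. number_field_hom splitting_field \<tau> \<and> \<tau> \<theta> = vertex_root i \<and> \<tau> \<beta> = vertex_root j" by blast
qed auto

end

section \<open>Squarefree coefficients\<close>

text \<open>The reverse implications hold because, were the squareness condition to fail, another of
  the three cases would apply and make the group isomorphic to a different one.\<close>

lemma galois_group_biquadratic:
  assumes irred: "Factorial_Ring.irreducible (map_poly rat_of_int [:b, 0, a, 0, 1:])"
  shows "galois_group [:b, 0, a, 0, 1:] \<cong> T4_1 \<longleftrightarrow> is_square (b * (a\<^sup>2 - 4 * b))"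
    and "galois_group [:b, 0, a, 0, 1:] \<cong> T4_2 \<longleftrightarrow> is_square b"
    and "galois_group [:b, 0, a, 0, 1:] \<cong> T4_3 \<longleftrightarrow> \<not> is_square b \<and> \<not> is_square (b * (a\<^sup>2 - 4 * b))"
proof -
  obtain \<theta> where "\<theta> \<in> complex_roots [:b, 0, a, 0, 1:]" using complex_roots_nonempty by blast
  then interpret biquadratic_roots a b \<theta> "csqrt (- of_int a - \<theta>\<^sup>2)"
    using irred by unfold_locales (simp_all add: complex_roots_iff)
  note N = not_isomorphic_T4[OF closed_G]
  show "G \<cong> T4_1 \<longleftrightarrow> is_square (b * (a\<^sup>2 - 4 * b))" "G \<cong> T4_2 \<longleftrightarrow> is_square b"
    "G \<cong> T4_3 \<longleftrightarrow> \<not> is_square b \<and> \<not> is_square (b * (a\<^sup>2 - 4 * b))"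
    using N galois_group_klein galois_group_cyclic galois_group_dihedral by blast+
qed

text \<open>After division by the gcd the cofactors are coprime with square product, so a prime
  dividing one would divide it twice. Both are therefore units, and nonnegativity of their product
  makes the signs agree.\<close>

lemma squarefree_eq_if_mult_square:
  fixes m n k :: int
  assumes "squarefree m" "squarefree n" "m * n = k\<^sup>2" "m * n \<noteq> 0"
  shows "m = n"
proof -
  define d where "d = gcd m n"
  have d: "d \<noteq> 0" using assms(4) by (auto simp: d_def)
  then have "\<exists>m' n'. m = m' * d \<and> n = n' * d \<and> coprime m' n'"
    unfolding d_def by (rule gcd_coprime_exists)
  then obtain m' n' where "m = m' * d" "n = n' * d" and co: "coprime m' n'" by blast
  then have mn: "m = d * m'" "n = d * n'" by simp_all
  have "d\<^sup>2 * (m' * n') = k\<^sup>2" using assms(3) by (simp add: mn power2_eq_square algebra_simps)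
  then have "d\<^sup>2 dvd k\<^sup>2" by (metis dvd_triv_left)
  then have "d dvd k" by simp
  then obtain k' where k: "k = d * k'" ..
  have eq: "m' * n' = k'\<^sup>2"
    using \<open>d\<^sup>2 * (m' * n') = k\<^sup>2\<close> d by (simp add: k power_mult_distrib)
  have unit: "is_unit x" if xy: "coprime x y" "x * y = k'\<^sup>2" "squarefree x" "x \<noteq> 0" for x y :: int
  proof (rule ccontr)
    assume "\<not> is_unit x"
    then obtain p where p: "prime p" "p dvd x" using xy(4) prime_divisor_exists by blast
    then have "p dvd k'\<^sup>2" using xy(2) by (metis dvd_mult2)
    then have "p dvd k'" using p(1) by (simp add: prime_dvd_power_iff)
    then have "p\<^sup>2 dvd x * y" using xy(2) by simp
    moreover have "coprime (p\<^sup>2) y"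
      using xy(1) p(2) by (meson coprime_divisors coprime_power_left_iff dvd_refl)
    ultimately have "p\<^sup>2 dvd x" by (simp add: coprime_dvd_mult_left_iff)
    then have "is_unit p" using xy(3) by (auto simp: squarefree_def)
    then show False using p(1) not_prime_unit by blast
  qed
  have sf: "squarefree m'" "squarefree n'"
    using assms(1,2) unfolding mn squarefree_def by (meson dvd_mult)+
  have nz: "m' \<noteq> 0" "n' \<noteq> 0" using assms(4) mn by auto
  have "is_unit m'" using unit[OF co eq sf(1) nz(1)] .
  moreover have "is_unit n'"
    using unit[of n' m'] co eq sf(2) nz(2) by (simp add: coprime_commute mult.commute)
  moreover have "m' * n' \<ge> 0" by (simp add: eq)
  ultimately have "m' = n'" by (auto simp: abs_if split: if_splits)
  then show ?thesis by (simp add: mn)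
qed

lemma squarefree_unit_if_square_dvd: "squarefree (n :: int) \<Longrightarrow> k\<^sup>2 dvd n \<Longrightarrow> k = 1 \<or> k = -1"
  by (auto simp: squarefree_def)

lemma reduced_discriminant_mult: "a\<^sup>2 - 4 * b = reduced_discriminant a b * (gcd 2 a)\<^sup>2"
  using gcd_2_power2_dvd[of a b] by (simp add: reduced_discriminant_def)

text \<open>Dropping the square factor from \<delta> makes \<open>b\<close> times the reduced
  discriminant a square, so the two coincide. This reads 2 b = (a / 2)^2 or 5 b = a^2, and
  squarefreeness of \<open>b\<close> then bounds \<open>a\<close>.\<close>

lemma cyclic_coefficients:
  assumes b: "squarefree b" and W: "squarefree (reduced_discriminant a b)" and "b \<noteq> 0"
    and nz: "a\<^sup>2 - 4 * b \<noteq> 0"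
    and R: "(a mod 4, b mod 4) \<in> biquadratic_residues" and sq: "is_square (b * (a\<^sup>2 - 4 * b))"
  shows "(a, b) \<in> {(4, 2), (-4, 2), (-5, 5)}"
proof -
  obtain k where k: "b * (a\<^sup>2 - 4 * b) = k\<^sup>2" using sq by (auto simp: is_nth_power_def)
  define g where "g = gcd 2 a"
  have g: "g \<noteq> 0" by (simp add: g_def)
  have kg: "g\<^sup>2 * (b * reduced_discriminant a b) = k\<^sup>2"
    using k reduced_discriminant_mult[of a b] by (simp add: g_def algebra_simps)
  then have "g\<^sup>2 dvd k\<^sup>2" by (metis dvd_triv_left)
  then obtain k' where "k = g * k'" by auto
  then have "b * reduced_discriminant a b = k'\<^sup>2"
    using kg g by (simp add: power_mult_distrib)
  moreover have "b * reduced_discriminant a b \<noteq> 0"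
    using nz \<open>b \<noteq> 0\<close> reduced_discriminant_mult[of a b] by auto
  ultimately have bW: "b = reduced_discriminant a b"
    by (rule squarefree_eq_if_mult_square[OF b W])
  show ?thesis
  proof (cases "even a")
    case True
    then obtain e where e: "a = 2 * e" ..
    then have eq: "2 * b = e\<^sup>2" using bW reduced_discriminant_even[OF True, of b] by simp
    then have "even (e\<^sup>2)" by (metis dvd_triv_left)
    then have "even e" by simp
    then obtain h where h: "e = 2 * h" ..
    then have "b = 2 * h\<^sup>2" using eq by (simp add: power_mult_distrib)
    then have "h = 1 \<or> h = -1" "b = 2 * h\<^sup>2"
      using squarefree_unit_if_square_dvd[OF b, of h] by simp_all
    then show ?thesis using e h by auto
  next
    case False
    then have eq: "5 * b = a\<^sup>2" using bW reduced_discriminant_odd[OF False, of b] by simp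
    then have "5 dvd a\<^sup>2" by (metis dvd_triv_left)
    moreover have "prime (5 :: int)" by simp
    ultimately have "5 dvd a" using prime_dvd_power by blast
    then obtain h where h: "a = 5 * h" ..
    then have "b = 5 * h\<^sup>2" using eq by (simp add: power_mult_distrib)
    then have "h = 1 \<or> h = -1" "b = 5 * h\<^sup>2"
      using squarefree_unit_if_square_dvd[OF b, of h] by simp_all
    \<comment> \<open>The residues exclude a = 5, b = 5, which is the pair (1,1) modulo 4.\<close>
    then show ?thesis using h R by (auto simp: biquadratic_residues_def)
  qed
qed

lemma squarefree_square_eq_1:
  assumes "squarefree (b :: int)" "is_square b"
  shows "b = 1"
proof -
  obtain k where k: "b = k\<^sup>2" using assms(2) by (auto simp: is_nth_power_def)
  then show ?thesis using squarefree_unit_if_square_dvd[OF assms(1), of k] by auto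
qed

theorem theorem2p6:
  fixes a b \<delta> W :: int and g4 :: "int poly"
  assumes "a * b \<noteq> 0"
    and "g4 = [:b, 0, a, 0, 1:]"
    and "\<delta> = a\<^sup>2 - 4 * b"
    and "W = \<delta> div (gcd 2 a)\<^sup>2"
    and "Factorial_Ring.irreducible (map_poly rat_of_int g4)"
  shows
    "(monogenic g4 \<and> galois_group g4 \<cong> T4_1 \<longleftrightarrow>
        g4 \<in> {[:2, 0, 4, 0, 1:], [:2, 0, -4, 0, 1:], [:5, 0, -5, 0, 1:]}) \<and>
     (monogenic g4 \<and> galois_group g4 \<cong> T4_2 \<longleftrightarrow>
        squarefree W \<and> g4 = [:1, 0, a, 0, 1:] \<and> a mod 4 \<in> {0, 3}) \<and>
     (monogenic g4 \<and> galois_group g4 \<cong> T4_3 \<longleftrightarrow>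
        squarefree W \<and> b \<noteq> 1 \<and> squarefree b \<and> \<not> is_square (b * \<delta>) \<and>
        (a mod 4, b mod 4) \<in> {(0,1), (0,2), (2,2), (2,3), (1,3), (3,2), (3,1), (3,3)})"
proof -
  note g4 = \<open>g4 = [:b, 0, a, 0, 1:]\<close> and \<delta> = \<open>\<delta> = a\<^sup>2 - 4 * b\<close>
  have b0: "b \<noteq> 0" using assms(1) by auto
  have W: "W = reduced_discriminant a b" by (simp add: assms(3,4) reduced_discriminant_def)
  have irred: "Factorial_Ring.irreducible (map_poly rat_of_int [:b, 0, a, 0, 1:])"
    using assms(2,5) by simp
  note mono = monogenic_biquadratic_iff[OF irred b0, folded g4 W]
  note gal = galois_group_biquadratic[OF irred, folded g4 \<delta>]
  have "squarefree (2 :: int)" "squarefree (5 :: int)"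
    by (simp_all add: squarefree_prime)
  have 1: "squarefree b \<and> squarefree W \<and> (a mod 4, b mod 4) \<in> biquadratic_residues \<and> is_square (b * \<delta>) \<longleftrightarrow>
      (a, b) \<in> {(4, 2), (-4, 2), (-5, 5)}"
  proof
    assume *: "squarefree b \<and> squarefree W \<and> (a mod 4, b mod 4) \<in> biquadratic_residues \<and> is_square (b * \<delta>)"
    then have "reduced_discriminant a b \<noteq> 0" by (auto simp: W)
    then have "a\<^sup>2 - 4 * b \<noteq> 0" using reduced_discriminant_mult[of a b] by simp
    with * show "(a, b) \<in> {(4, 2), (-4, 2), (-5, 5)}"
      using cyclic_coefficients[of b a] b0 by (simp add: W \<delta>)
  next
    assume *: "(a, b) \<in> {(4, 2), (-4, 2), (-5, 5)}"
    \<comment> \<open>16 and 25 are the values of \<open>b * \<delta>\<close> for the listed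
      polynomials.\<close>
    have "(16 :: int) = 4\<^sup>2" "(25 :: int) = 5\<^sup>2" by simp_all
    then have sq: "is_square (16 :: int)" "is_square (25 :: int)"
      unfolding is_nth_power_def by blast+
    from * consider "a = 4" "b = 2" | "a = -4" "b = 2" | "a = -5" "b = 5" by blast
    then show "squarefree b \<and> squarefree W \<and> (a mod 4, b mod 4) \<in> biquadratic_residues \<and> is_square (b * \<delta>)"
      by cases (simp_all add: sq \<open>squarefree 2\<close> \<open>squarefree 5\<close> W \<delta> reduced_discriminant_even reduced_discriminant_odd biquadratic_residues_def)
  qed
  have 2: "squarefree b \<and> squarefree W \<and> (a mod 4, b mod 4) \<in> biquadratic_residues \<and> is_square b \<longleftrightarrow>
      squarefree W \<and> b = 1 \<and> a mod 4 \<in> {0, 3}"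
  proof -
    have "(a mod 4, b mod 4) \<in> biquadratic_residues \<longleftrightarrow> a mod 4 \<in> {0, 3}" if "b = 1"
      by (simp add: that biquadratic_residues_def)
    then show ?thesis using squarefree_square_eq_1[of b] by auto
  qed
  have 3: "squarefree b \<Longrightarrow> is_square b \<longleftrightarrow> b = 1"
    using squarefree_square_eq_1[of b] by auto
  have 4: "g4 \<in> {[:2, 0, 4, 0, 1:], [:2, 0, -4, 0, 1:], [:5, 0, -5, 0, 1:]} \<longleftrightarrow> (a, b) \<in> {(4, 2), (-4, 2), (-5, 5)}"
    "g4 = [:1, 0, a, 0, 1:] \<longleftrightarrow> b = 1"
    by (auto simp: g4)
  show ?thesis
    unfolding mono gal 4 biquadratic_residues_def[symmetric]
    using 1 2 3 by blast
qed

end
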